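(* Let $\mathfrak{L}_\pm$ be dual definite subspaces of the Krein space $(\mathfrak{H},[\cdot,\cdot])$ whose algebraic sum $\mathfrak{L}_++\mathfrak{L}_-$ is dense in $\mathfrak{H}$. Assume that the corresponding operator $G_0$ does not have a unique nonnegative self-adjoint extension (equivalently, $T_\mu\neq T_M$). Then $\mathfrak{L}_\pm$ are quasi maximal if and only if the Krein space $(\mathfrak{M},[\cdot,\cdot])$, $\mathfrak{M}=\overline{R(T_M-T_\mu)}$, contains a hypermaximal neutral subspace.
   Context: $\mathfrak{H}$ is a complex Hilbert space with inner product $(\cdot,\cdot)$ (linear in the first argument), $J$ is a bounded operator with $J=J^*$, $J^2=I$, $J\neq\pm I$, and $[f,g]=(Jf,g)$. Put $P_\pm=\frac12(I\pm J)$, $\mathfrak{H}_\pm=P_\pm\mathfrak{H}$. Subspaces are closed. Dual definite subspaces $\mathfrak{L}_\pm$: $[f,f]>0$ for $0\ne f\in\mathfrak{L}_+$, $[f,f]<0$ for $0\neq f\in\mathfrak{L}_-$, and $[f_+,f_-]=0$ for all $f_\pm\in\mathfrak{L}_\pm$. Associated operators: $\mathfrak{L}_\pm$ can be written uniquely as $\mathfrak{L}_+=\{x_++K_+^-x_+:x_+\in M_+\}$, $\mathfrak{L}_-=\{x_-+K_-^+x_-:x_-\in M_-\}$ with $M_\pm$ closed subspaces of $\mathfrak{H}_\pm$ and $K_+^-:M_+\to\mathfrak{H}_-$, $K_-^+:M_-\to\mathfrak{H}_+$ strong contractions ($\|Kf\|<\|f\|$ for $f\neq0$). Put $T_0=K_+^-P_++K_-^+P_-$,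 $D(T_0)=M_+\oplus M_-$ (a symmetric strong contraction, in general not densely defined, with $JT_0=-T_0J$) and $G_0=(I-T_0)(I+T_0)^{-1}$. Then $D(G_0)=\mathfrak{L}_++\mathfrak{L}_-$ and $G_0$ is a closed densely defined positive symmetric operator. "Positive" for an operator $G$ means $(Gf,f)>0$ for all $0\ne f\in D(G)$; every nonnegative self-adjoint extension of $G_0$ is positive. The set of all self-adjoint contractive extensions of $T_0$ (defined on $\mathfrak{H}$) is an operator interval $[T_\mu,T_M]$. The subspace $\mathfrak{M}=\overline{R(T_M-T_\mu)}$ reduces $J$, so $(\mathfrak{M},[\cdot,\cdot])$ is a Krein space with fundamental symmetry $J\upharpoonright_{\mathfrak{M}}$. A subspace $\mathfrak{M}_1\subset\mathfrak{M}$ is called hypermaximal neutral if $\mathfrak{M}=\mathfrak{M}_1\oplus J\mathfrak{M}_1$ (orthogonal sum with respect to $(\cdot,\cdot)$). For a positive self-adjoint extension $G\supset G_0$, $(\mathfrak{H}_G,(\cdot,\cdot)_G)$ denotes the completion of $D(G)$ with respect to $(f,g)_G=(Gf,g)$. The subspaces $\mathfrak{L}_\pm$ are called quasi maximal if there exists a positive self-adjoint extension $G\supset G_0$ with $JGf=G^{-1}Jf$ for all $f\in D(G)$ and such that $D(G_0)$ is dense in $(\mathfrak{H}_G,(\cdot,\cdot)_G)$. *)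

theory Defs
  imports "HOL-Analysis.Analysis"
begin

section \<open>Complex Hilbert spaces\<close>

text \<open>The inner product is linear in its first argument.\<close>

class complex_inner = real_normed_vector +
  fixes scaleC :: "complex \<Rightarrow> 'a \<Rightarrow> 'a"  (infixr "*\<^sub>C" 75)
    and cinner :: "'a \<Rightarrow> 'a \<Rightarrow> complex"
  assumes scaleC_add_right: "c *\<^sub>C (x + y) = c *\<^sub>C x + c *\<^sub>C y"
    and scaleC_add_left: "(c + d) *\<^sub>C x = c *\<^sub>C x + d *\<^sub>C x"
    and scaleC_scaleC: "c *\<^sub>C d *\<^sub>C x = (c * d) *\<^sub>C x"
    and scaleR_scaleC: "r *\<^sub>R x = complex_of_real r *\<^sub>C x"
    and cinner_add_left: "cinner (x + y) z = cinner x z + cinner y z"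
    and cinner_scaleC_left: "cinner (c *\<^sub>C x) y = c * cinner x y"
    and cinner_commute: "cinner x y = cnj (cinner y x)"
    and cinner_self: "cinner x x = complex_of_real ((norm x)\<^sup>2)"

class chilbert_space = complex_inner + complete_space

instantiation complex :: chilbert_space
begin

definition scaleC_complex :: "complex \<Rightarrow> complex \<Rightarrow> complex" where
  "scaleC_complex c x = c * x"

definition cinner_complex :: "complex \<Rightarrow> complex \<Rightarrow> complex" where
  "cinner_complex x y = x * cnj y"

instance
  by standard
    (simp_all add: scaleC_complex_def cinner_complex_def algebra_simps scaleR_conv_of_real
      complex_norm_square del: of_real_power)

end

instantiation prod :: (complex_inner, complex_inner) complex_inner
begin

definition scaleC_prod :: "complex \<Rightarrow> 'a \<times> 'b \<Rightarrow> 'a \<times> 'b" where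
  "scaleC_prod c x = (c *\<^sub>C fst x, c *\<^sub>C snd x)"

definition cinner_prod :: "'a \<times> 'b \<Rightarrow> 'a \<times> 'b \<Rightarrow> complex" where
  "cinner_prod x y = cinner (fst x) (fst y) + cinner (snd x) (snd y)"

instance
proof
  fix x y :: "'a \<times> 'b"
  show "cinner x y = cnj (cinner y x)"
    unfolding cinner_prod_def complex_cnj_add
    by (metis cinner_commute)
  show "cinner x x = complex_of_real ((norm x)\<^sup>2)"
    by (simp add: cinner_prod_def cinner_self norm_prod_def)
qed (simp_all add: scaleC_prod_def cinner_prod_def scaleC_add_right scaleC_add_left
      scaleC_scaleC scaleR_scaleC cinner_add_left cinner_scaleC_left algebra_simps
      scaleR_prod_def)

end

instance prod :: (chilbert_space, chilbert_space) chilbert_space ..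

definition csubspace :: "'a::complex_inner set \<Rightarrow> bool" where
  "csubspace S \<longleftrightarrow>
     0 \<in> S \<and> (\<forall>x\<in>S. \<forall>y\<in>S. x + y \<in> S) \<and> (\<forall>c. \<forall>x\<in>S. c *\<^sub>C x \<in> S)"

definition closed_csubspace :: "'a::complex_inner set \<Rightarrow> bool" where
  "closed_csubspace S \<longleftrightarrow> csubspace S \<and> closed S"

section \<open>Bounded operators on the whole space\<close>

definition bounded_selfadjoint :: "('a::complex_inner \<Rightarrow> 'a) \<Rightarrow> bool" where
  "bounded_selfadjoint T \<longleftrightarrow>
     bounded_linear T \<and> (\<forall>c x. T (c *\<^sub>C x) = c *\<^sub>C T x) \<and>
     (\<forall>x y. cinner (T x) y = cinner x (T y))"

definition op_le :: "('a::complex_inner \<Rightarrow> 'a) \<Rightarrow> ('a \<Rightarrow> 'a) \<Rightarrow> bool" where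
  "op_le A B \<longleftrightarrow> (\<forall>x. Re (cinner (A x) x) \<le> Re (cinner (B x) x))"

definition op_interval :: "('a::complex_inner \<Rightarrow> 'a) \<Rightarrow> ('a \<Rightarrow> 'a) \<Rightarrow> ('a \<Rightarrow> 'a) set" where
  "op_interval A B = {T. bounded_selfadjoint T \<and> op_le A T \<and> op_le T B}"

section \<open>Partially defined operators\<close>

text \<open>
  A partially defined linear operator is identified with its graph, so that extension is inclusion,
  the inverse is the converse relation, and \<open>Domain\<close> is the domain of the operator.
\<close>

type_synonym 'a graph = "('a \<times> 'a) set"

definition linear_op :: "'a::complex_inner graph \<Rightarrow> bool" where
  "linear_op A \<longleftrightarrow> csubspace A \<and> single_valued A"

definition op_app :: "'a graph \<Rightarrow> 'a \<Rightarrow> 'a" where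
  "op_app A f = (THE g. (f, g) \<in> A)"

definition adjoint_op :: "'a::complex_inner graph \<Rightarrow> 'a graph" where
  "adjoint_op A = {(g, h). \<forall>(f, k)\<in>A. cinner k g = cinner f h}"

definition selfadjoint_op :: "'a::complex_inner graph \<Rightarrow> bool" where
  "selfadjoint_op A \<longleftrightarrow> linear_op A \<and> closure (Domain A) = UNIV \<and> adjoint_op A = A"

text \<open>
  The next two predicates are only used for self-adjoint operators, whose quadratic form is real.
\<close>

definition nonnegative_op :: "'a::complex_inner graph \<Rightarrow> bool" where
  "nonnegative_op A \<longleftrightarrow> (\<forall>f\<in>Domain A. 0 \<le> Re (cinner (op_app A f) f))"

definition positive_op :: "'a::complex_inner graph \<Rightarrow> bool" where
  "positive_op A \<longleftrightarrow> (\<forall>f\<in>Domain A. f \<noteq> 0 \<longrightarrow> 0 < Re (cinner (op_app A f) f))"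

section \<open>The energy space of a positive operator\<close>

text \<open>
  The completion of \<open>Domain G\<close> with respect to \<open>(f, g)\<^sub>G = (G f, g)\<close>, realised as the
  Cauchy sequences modulo null sequences.
\<close>

definition energy_inner :: "'a::complex_inner graph \<Rightarrow> 'a \<Rightarrow> 'a \<Rightarrow> complex" where
  "energy_inner G f g = cinner (op_app G f) g"

definition energy_norm :: "'a::complex_inner graph \<Rightarrow> 'a \<Rightarrow> real" where
  "energy_norm G f = sqrt (Re (energy_inner G f f))"

definition energy_Cauchy :: "'a::complex_inner graph \<Rightarrow> (nat \<Rightarrow> 'a) set" where
  "energy_Cauchy G = {F. (\<forall>n. F n \<in> Domain G) \<and>
     (\<forall>e>0. \<exists>N. \<forall>m\<ge>N. \<forall>n\<ge>N. energy_norm G (F m - F n) < e)}"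

definition energy_rel :: "'a::complex_inner graph \<Rightarrow> (nat \<Rightarrow> 'a) rel" where
  "energy_rel G = {(F, H). F \<in> energy_Cauchy G \<and> H \<in> energy_Cauchy G \<and>
     (\<lambda>n. energy_norm G (F n - H n)) \<longlonglongrightarrow> 0}"

definition energy_completion :: "'a::complex_inner graph \<Rightarrow> (nat \<Rightarrow> 'a) set set" where
  "energy_completion G = energy_Cauchy G // energy_rel G"

definition energy_embed :: "'a::complex_inner graph \<Rightarrow> 'a \<Rightarrow> (nat \<Rightarrow> 'a) set" where
  "energy_embed G f = energy_rel G `` {\<lambda>n. f}"

definition energy_dist ::
  "'a::complex_inner graph \<Rightarrow> (nat \<Rightarrow> 'a) set \<Rightarrow> (nat \<Rightarrow> 'a) set \<Rightarrow> real" where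
  "energy_dist G X Y = lim (\<lambda>n. energy_norm G ((SOME F. F \<in> X) n - (SOME H. H \<in> Y) n))"

definition dense_in_energy_completion :: "'a::complex_inner set \<Rightarrow> 'a graph \<Rightarrow> bool" where
  "dense_in_energy_completion S G \<longleftrightarrow> S \<subseteq> Domain G \<and>
     (\<forall>X\<in>energy_completion G. \<forall>e>0. \<exists>f\<in>S. energy_dist G X (energy_embed G f) < e)"

section \<open>Krein spaces and dual definite subspaces\<close>

definition fundamental_symmetry :: "('a::complex_inner \<Rightarrow> 'a) \<Rightarrow> bool" where
  "fundamental_symmetry J \<longleftrightarrow>
     bounded_selfadjoint J \<and> (\<forall>x. J (J x) = x) \<and> J \<noteq> (\<lambda>x. x) \<and> J \<noteq> (\<lambda>x. - x)"

definition krein_inner :: "('a::complex_inner \<Rightarrow> 'a) \<Rightarrow> 'a \<Rightarrow> 'a \<Rightarrow> complex" where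
  "krein_inner J f g = cinner (J f) g"

definition P_plus :: "('a::complex_inner \<Rightarrow> 'a) \<Rightarrow> 'a \<Rightarrow> 'a" where
  "P_plus J f = (1/2) *\<^sub>R (f + J f)"

definition P_minus :: "('a::complex_inner \<Rightarrow> 'a) \<Rightarrow> 'a \<Rightarrow> 'a" where
  "P_minus J f = (1/2) *\<^sub>R (f - J f)"

definition dual_definite :: "('a::complex_inner \<Rightarrow> 'a) \<Rightarrow> 'a set \<Rightarrow> 'a set \<Rightarrow> bool" where
  "dual_definite J Lp Lm \<longleftrightarrow>
     closed_csubspace Lp \<and> closed_csubspace Lm \<and>
     (\<forall>f\<in>Lp. f \<noteq> 0 \<longrightarrow> 0 < Re (krein_inner J f f)) \<and>
     (\<forall>f\<in>Lm. f \<noteq> 0 \<longrightarrow> Re (krein_inner J f f) < 0) \<and>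
     (\<forall>f\<in>Lp. \<forall>g\<in>Lm. krein_inner J f g = 0)"

text \<open>
  The representation \<open>Lp = {x + K x | x \<in> M}\<close> with \<open>x\<close> in the range of \<open>P_plus J\<close> and
  \<open>K x\<close> in the range of \<open>P_minus J\<close> forces \<open>x = P_plus J f\<close> and \<open>K x = P_minus J f\<close>
  for \<open>f = x + K x\<close>, which determines the graph of \<open>K\<close>; likewise for \<open>Lm\<close>.
\<close>

definition K_plus :: "('a::complex_inner \<Rightarrow> 'a) \<Rightarrow> 'a set \<Rightarrow> 'a graph" where
  "K_plus J Lp = {(P_plus J f, P_minus J f) |f. f \<in> Lp}"

definition K_minus :: "('a::complex_inner \<Rightarrow> 'a) \<Rightarrow> 'a set \<Rightarrow> 'a graph" where
  "K_minus J Lm = {(P_minus J f, P_plus J f) |f. f \<in> Lm}"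

definition T_zero :: "('a::complex_inner \<Rightarrow> 'a) \<Rightarrow> 'a set \<Rightarrow> 'a set \<Rightarrow> 'a graph" where
  "T_zero J Lp Lm =
     {(x + x', y + y') |x y x' y'. (x, y) \<in> K_plus J Lp \<and> (x', y') \<in> K_minus J Lm}"

text \<open>\<open>(I - T\<^sub>0) (I + T\<^sub>0)\<^sup>-\<^sup>1\<close>; relational composition applies its left argument first.\<close>

definition G_zero :: "('a::complex_inner \<Rightarrow> 'a) \<Rightarrow> 'a set \<Rightarrow> 'a set \<Rightarrow> 'a graph" where
  "G_zero J Lp Lm =
     {(x, x + y) |x y. (x, y) \<in> T_zero J Lp Lm}\<inverse> O {(x, x - y) |x y. (x, y) \<in> T_zero J Lp Lm}"

definition nonnegative_sa_extension :: "'a::complex_inner graph \<Rightarrow> 'a graph \<Rightarrow> bool" where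
  "nonnegative_sa_extension A G \<longleftrightarrow> A \<subseteq> G \<and> selfadjoint_op G \<and> nonnegative_op G"

definition positive_sa_extension :: "'a::complex_inner graph \<Rightarrow> 'a graph \<Rightarrow> bool" where
  "positive_sa_extension A G \<longleftrightarrow> A \<subseteq> G \<and> selfadjoint_op G \<and> positive_op G"

definition quasi_maximal :: "('a::complex_inner \<Rightarrow> 'a) \<Rightarrow> 'a set \<Rightarrow> 'a set \<Rightarrow> bool" where
  "quasi_maximal J Lp Lm \<longleftrightarrow>
     (\<exists>G. positive_sa_extension (G_zero J Lp Lm) G \<and>
          (\<forall>f\<in>Domain G. (J f, J (op_app G f)) \<in> G\<inverse>) \<and>
          dense_in_energy_completion (Domain (G_zero J Lp Lm)) G)"

definition sa_contractive_extensions :: "'a::complex_inner graph \<Rightarrow> ('a \<Rightarrow> 'a) set" where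
  "sa_contractive_extensions A =
     {T. bounded_selfadjoint T \<and> (\<forall>x. norm (T x) \<le> norm x) \<and> (\<forall>(x, y)\<in>A. T x = y)}"

text \<open>
  The end points of the operator interval formed by the self-adjoint contractive extensions of
  \<open>T\<^sub>0\<close>. They are unique: a nonempty operator interval determines its end points.
\<close>

definition T_mu :: "('a::complex_inner \<Rightarrow> 'a) \<Rightarrow> 'a set \<Rightarrow> 'a set \<Rightarrow> 'a \<Rightarrow> 'a" where
  "T_mu J Lp Lm = (THE A. \<exists>B. bounded_selfadjoint A \<and> bounded_selfadjoint B \<and>
     sa_contractive_extensions (T_zero J Lp Lm) = op_interval A B)"

definition T_M :: "('a::complex_inner \<Rightarrow> 'a) \<Rightarrow> 'a set \<Rightarrow> 'a set \<Rightarrow> 'a \<Rightarrow> 'a" where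
  "T_M J Lp Lm = (THE B. \<exists>A. bounded_selfadjoint A \<and> bounded_selfadjoint B \<and>
     sa_contractive_extensions (T_zero J Lp Lm) = op_interval A B)"

definition M_space :: "('a::complex_inner \<Rightarrow> 'a) \<Rightarrow> 'a set \<Rightarrow> 'a set \<Rightarrow> 'a set" where
  "M_space J Lp Lm = closure (range (\<lambda>x. T_M J Lp Lm x - T_mu J Lp Lm x))"

definition hypermaximal_neutral :: "('a::complex_inner \<Rightarrow> 'a) \<Rightarrow> 'a set \<Rightarrow> 'a set \<Rightarrow> bool" where
  "hypermaximal_neutral J M M1 \<longleftrightarrow>
     closed_csubspace M1 \<and> M1 \<subseteq> M \<and>
     (\<forall>f\<in>M1. \<forall>g\<in>J ` M1. cinner f g = 0) \<and>
     M = {f + g |f g. f \<in> M1 \<and> g \<in> J ` M1}"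

end

theory Submission
  imports Defs
begin

text \<open>
  The Cayley transform \<open>T = (I - G) (I + G)\<^sup>-\<^sup>1\<close> turns the positive self-adjoint extensions
  \<open>G\<close> of \<open>G\<^sub>0\<close> into the self-adjoint contractive extensions \<open>T\<close> of \<open>T\<^sub>0\<close>. The
  condition \<open>J G = G\<^sup>-\<^sup>1 J\<close> becomes \<open>J T = - T J\<close>. For \<open>f = x + T x\<close> the energy
  \<open>(G f, f)\<close> is \<open>\<parallel>x\<parallel>\<^sup>2 - \<parallel>T x\<parallel>\<^sup>2\<close>, the form of \<open>I - T\<^sup>2\<close> at \<open>x\<close>; so
  density of the domain of \<open>G\<^sub>0\<close> in the energy space means that this form can be made arbitrarily
  small on each coset \<open>x + S\<close>, where \<open>S\<close> is the domain of \<open>T\<^sub>0\<close>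
  (\<open>quasi_maximal_iff\<close>).

  The operator \<open>I - T\<^sup>2\<close> is twice the parallel sum of \<open>I + T\<close> and \<open>I - T\<close>, by
  completing a square (\<open>parallel_sum_identity\<close>). The infima over cosets of \<open>S\<close> can
  be taken in the two summands separately, where they give the forms of \<open>T - T\<^sub>\<mu>\<close> and of
  \<open>T\<^sub>M - T\<close>: the extremal extensions are characterized by the vanishing of the infima for
  \<open>I + T\<^sub>\<mu>\<close> and \<open>I - T\<^sub>M\<close>. So density holds if and only if the parallel sum of
  \<open>T - T\<^sub>\<mu>\<close> and \<open>T\<^sub>M - T\<close> vanishes (\<open>null_defect_iff\<close>).

  Let \<open>V\<close> be the positive square root of \<open>T\<^sub>M - T\<^sub>\<mu>\<close>; its closed range is \<open>M\<close>. The
  extensions are \<open>T = T\<^sub>\<mu> + V C V\<close> with \<open>0 \<le> C \<le> I\<close> on \<open>M\<close>, and the parallel sum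
  of \<open>V C V\<close> and \<open>V (I - C) V\<close> is \<open>V (C - C\<^sup>2) V\<close>. It vanishes if and only if
  \<open>C\<close> is an orthogonal projection. Since \<open>J T\<^sub>\<mu> J = - T\<^sub>M\<close>, the operator \<open>V\<close>
  commutes with \<open>J\<close>, and \<open>J T = - T J\<close> becomes \<open>J C J = I - C\<close> on \<open>M\<close>. A projection
  \<open>C\<close> with this property is the projection onto a hypermaximal neutral subspace of \<open>M\<close>, and
  every such subspace arises in this way (\<open>hypermaximal_of_quasi_maximal\<close>,
  \<open>quasi_maximal_of_hypermaximal\<close>).

  The analytic tools are a representation theorem for functionals bounded by \<open>\<parallel>A x\<parallel>\<close>, which
  contains Douglas' factorization lemma, adjoints and projections (\<open>douglas_factorization\<close>),
  the square root of a positive operator (\<open>positive_sqrt_exists\<close>), and Krein's theorem on the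
  interval of contractive extensions (\<open>extremal_pair_exists\<close>).
\<close>

section \<open>Inner products and subspaces\<close>

lemma cinner_add_right: "cinner x (y + z) = cinner x y + cinner x (z::'a::complex_inner)"
  by (metis cinner_add_left cinner_commute complex_cnj_add)

lemma cinner_scaleC_right: "cinner x (c *\<^sub>C y) = cnj c * cinner x (y::'a::complex_inner)"
  by (metis cinner_scaleC_left cinner_commute complex_cnj_mult)

lemma cinner_scaleR_left: "cinner (r *\<^sub>R x) (y::'a::complex_inner) = of_real r * cinner x y"
  by (simp add: scaleR_scaleC cinner_scaleC_left)

lemma cinner_scaleR_right: "cinner x (r *\<^sub>R y::'a::complex_inner) = of_real r * cinner x y"
  by (simp add: scaleR_scaleC cinner_scaleC_right)

lemma cinner_zero_left [simp]: "cinner 0 (y::'a::complex_inner) = 0"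
  using cinner_scaleR_left[of 0 0 y] by simp

lemma cinner_zero_right [simp]: "cinner x (0::'a::complex_inner) = 0"
  using cinner_scaleR_right[of x 0 0] by simp

lemma cinner_minus_left: "cinner (- x) (y::'a::complex_inner) = - cinner x y"
  using cinner_scaleR_left[of "-1" x y] by simp

lemma cinner_minus_right: "cinner x (- y::'a::complex_inner) = - cinner x y"
  using cinner_scaleR_right[of x "-1" y] by simp

lemma cinner_diff_left: "cinner (x - y) (z::'a::complex_inner) = cinner x z - cinner y z"
  using cinner_add_left[of x "- y" z] by (simp add: cinner_minus_left)

lemma cinner_diff_right: "cinner x (y - z::'a::complex_inner) = cinner x y - cinner x z"
  using cinner_add_right[of x y "- z"] by (simp add: cinner_minus_right)

lemmas cinner_simps = cinner_add_left cinner_add_right cinner_diff_left cinner_diff_right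
  cinner_minus_left cinner_minus_right cinner_scaleR_left cinner_scaleR_right

lemma Re_cinner_commute: "Re (cinner x y) = Re (cinner y (x::'a::complex_inner))"
  by (subst cinner_commute) simp

lemma norm_sq_cinner: "(norm x)\<^sup>2 = Re (cinner x (x::'a::complex_inner))"
  by (simp add: cinner_self del: of_real_power)

lemma norm_sq_add: "(norm (x + y))\<^sup>2 = (norm x)\<^sup>2 + 2 * Re (cinner x y) + (norm (y::'a::complex_inner))\<^sup>2"
  by (simp add: norm_sq_cinner cinner_simps Re_cinner_commute[of y x])

lemma norm_sq_diff: "(norm (x - y))\<^sup>2 = (norm x)\<^sup>2 - 2 * Re (cinner x y) + (norm (y::'a::complex_inner))\<^sup>2"
  by (simp add: norm_sq_cinner cinner_simps Re_cinner_commute[of y x])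

lemma scaleC_zero_right [simp]: "c *\<^sub>C (0::'a::complex_inner) = 0"
  using scaleC_add_right[of c 0 "0::'a"] by simp

lemma scaleC_minus_right: "c *\<^sub>C (- x::'a::complex_inner) = - (c *\<^sub>C x)"
  using scaleC_add_right[of c x "- x"] by (simp add: eq_neg_iff_add_eq_0 add.commute)

lemma scaleC_diff_right: "c *\<^sub>C (x - y::'a::complex_inner) = c *\<^sub>C x - c *\<^sub>C y"
  using scaleC_add_right[of c x "- y"] by (simp add: scaleC_minus_right)

lemma scaleC_scaleR: "c *\<^sub>C (r *\<^sub>R x::'a::complex_inner) = r *\<^sub>R (c *\<^sub>C x)"
  by (simp add: scaleR_scaleC scaleC_scaleC mult.commute)

lemma norm_scaleC: "norm (c *\<^sub>C x::'a::complex_inner) = cmod c * norm x"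
proof -
  have "complex_of_real ((norm (c *\<^sub>C x))\<^sup>2) = c * cnj c * cinner x x"
    unfolding cinner_self[symmetric] by (simp add: cinner_scaleC_left cinner_scaleC_right)
  also have "\<dots> = complex_of_real ((cmod c * norm x)\<^sup>2)"
    by (simp only: cinner_self complex_norm_square[symmetric] power_mult_distrib of_real_mult)
  finally have "(norm (c *\<^sub>C x))\<^sup>2 = (cmod c * norm x)\<^sup>2"
    using of_real_eq_iff by blast
  then show ?thesis by (simp add: power2_eq_iff_nonneg)
qed

text \<open>The triangle inequality of the norm already contains the real Cauchy--Schwarz inequality; a
  rotation of one argument gives the complex one.\<close>

lemma Re_cinner_le: "Re (cinner x y) \<le> norm x * norm (y::'a::complex_inner)"
proof -
  have "(norm (x + y))\<^sup>2 \<le> (norm x + norm y)\<^sup>2"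
    by (simp add: norm_triangle_ineq power_mono)
  then show ?thesis by (simp add: norm_sq_add power2_sum)
qed

lemma norm_cinner_le: "cmod (cinner x y) \<le> norm x * norm (y::'a::complex_inner)"
proof (cases "cinner x y = 0")
  case False
  define w where "w = cinner x y"
  define c where "c = of_real (cmod w) / w"
  have "w \<noteq> 0" using False by (simp add: w_def)
  then have "cmod c = 1" "c * w = of_real (cmod w)" by (simp_all add: c_def norm_divide)
  then have "cmod w = Re (cinner (c *\<^sub>C x) y)"
    by (simp add: cinner_scaleC_left w_def)
  also have "\<dots> \<le> norm x * norm y"
    using Re_cinner_le[of "c *\<^sub>C x" y] \<open>cmod c = 1\<close> by (simp add: norm_scaleC)
  finally show ?thesis by (simp add: w_def)
qed simp

lemma bounded_bilinear_cinner:
  "bounded_bilinear (cinner :: 'a::complex_inner \<Rightarrow> 'a \<Rightarrow> complex)"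
  by (rule bounded_bilinear.intro)
    (auto simp: cinner_simps scaleR_conv_of_real intro!: exI[of _ 1] norm_cinner_le)

lemmas tendsto_cinner = bounded_bilinear.tendsto[OF bounded_bilinear_cinner]

lemma cinner_eqI:
  assumes "\<And>x. cinner x y = cinner x (z::'a::complex_inner)"
  shows "y = z"
proof -
  have "cinner (y - z) (y - z) = 0"
    using assms[of "y - z"] by (simp add: cinner_diff_right)
  then show ?thesis by (simp add: cinner_self)
qed

lemma complex_eq_by_rotation:
  assumes "Re a = Re b" "Re (\<i> * a) = Re (\<i> * b)"
  shows "a = b"
  using assms by (simp add: complex_eq_iff)

lemma csubspace_0: "csubspace S \<Longrightarrow> 0 \<in> S"
  and csubspace_add: "csubspace S \<Longrightarrow> x \<in> S \<Longrightarrow> y \<in> S \<Longrightarrow> x + y \<in> S"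
  and csubspace_scaleC: "csubspace S \<Longrightarrow> x \<in> S \<Longrightarrow> c *\<^sub>C x \<in> S"
  by (auto simp: csubspace_def)

lemma csubspace_scaleR: "csubspace S \<Longrightarrow> x \<in> S \<Longrightarrow> r *\<^sub>R x \<in> S"
  by (simp add: scaleR_scaleC csubspace_scaleC)

lemma csubspace_minus: "csubspace S \<Longrightarrow> x \<in> S \<Longrightarrow> - x \<in> S"
  using csubspace_scaleR[of S x "-1"] by simp

lemma csubspace_diff: "csubspace S \<Longrightarrow> x \<in> S \<Longrightarrow> y \<in> S \<Longrightarrow> x - y \<in> S"
  using csubspace_add[of S x "- y"] csubspace_minus[of S y] by simp

lemma csubspace_UNIV: "csubspace UNIV"
  by (simp add: csubspace_def)

section \<open>Representation of functionals and factorization\<close>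

definition bounded_clinear :: "('a::complex_inner \<Rightarrow> 'b::complex_inner) \<Rightarrow> bool" where
  "bounded_clinear T \<longleftrightarrow> bounded_linear T \<and> (\<forall>c x. T (c *\<^sub>C x) = c *\<^sub>C T x)"

text \<open>Linearity is required on a subspace only, so that \<open>E\<close> can be the graph of a partially
  defined operator.\<close>

definition clinear_on :: "'b::complex_inner set \<Rightarrow> ('b \<Rightarrow> 'a::complex_inner) \<Rightarrow> bool" where
  "clinear_on E A \<longleftrightarrow> (\<forall>x\<in>E. \<forall>y\<in>E. A (x + y) = A x + A y) \<and> (\<forall>c. \<forall>x\<in>E. A (c *\<^sub>C x) = c *\<^sub>C A x)"

lemma clinear_on_add: "clinear_on E A \<Longrightarrow> x \<in> E \<Longrightarrow> y \<in> E \<Longrightarrow> A (x + y) = A x + A y"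
  and clinear_on_scaleC: "clinear_on E A \<Longrightarrow> x \<in> E \<Longrightarrow> A (c *\<^sub>C x) = c *\<^sub>C A x"
  by (auto simp: clinear_on_def)

lemma clinear_on_scaleR: "clinear_on E A \<Longrightarrow> x \<in> E \<Longrightarrow> A (r *\<^sub>R x) = r *\<^sub>R A x"
  by (simp add: scaleR_scaleC clinear_on_scaleC)

lemma csubspace_image:
  assumes "csubspace E" "clinear_on E A"
  shows "csubspace (A ` E)"
  unfolding csubspace_def
proof safe
  have "A 0 = 0" using clinear_on_scaleR[OF assms(2) csubspace_0[OF assms(1)], of 0] by simp
  then show "0 \<in> A ` E" using csubspace_0[OF assms(1)] by force
next
  fix x y assume "x \<in> E" "y \<in> E"
  then show "A x + A y \<in> A ` E"
    using clinear_on_add[OF assms(2)] csubspace_add[OF assms(1)] by (metis imageI)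
next
  fix c x assume "x \<in> E"
  then show "c *\<^sub>C A x \<in> A ` E"
    using clinear_on_scaleC[OF assms(2)] csubspace_scaleC[OF assms(1)] by (metis imageI)
qed

lemma bounded_linear_scaleC: "bounded_linear (\<lambda>x. c *\<^sub>C (x::'a::complex_inner))"
  by (rule bounded_linear_intro[where K = "cmod c"])
    (auto simp: scaleC_add_right scaleC_scaleR norm_scaleC mult.commute)

lemma csubspace_closure:
  assumes "csubspace S"
  shows "csubspace (closure S)"
  unfolding csubspace_def
proof safe
  show "0 \<in> closure S" using csubspace_0[OF assms] closure_subset by blast
next
  fix x y assume "x \<in> closure S" "y \<in> closure S"
  then obtain f g where "\<And>n. f n \<in> S" "f \<longlonglongrightarrow> x" "\<And>n. g n \<in> S" "g \<longlonglongrightarrow> y"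
    unfolding closure_sequential by blast
  then have "\<And>n. f n + g n \<in> S" "(\<lambda>n. f n + g n) \<longlonglongrightarrow> x + y"
    using csubspace_add[OF assms] by (auto intro: tendsto_add)
  then show "x + y \<in> closure S" unfolding closure_sequential by (intro exI[of _ "\<lambda>n. f n + g n"]) auto
next
  fix c x assume "x \<in> closure S"
  then obtain f where "\<And>n. f n \<in> S" "f \<longlonglongrightarrow> x"
    unfolding closure_sequential by blast
  then have "\<And>n. c *\<^sub>C f n \<in> S" "(\<lambda>n. c *\<^sub>C f n) \<longlonglongrightarrow> c *\<^sub>C x"
    using csubspace_scaleC[OF assms] bounded_linear.tendsto[OF bounded_linear_scaleC] by auto
  then show "c *\<^sub>C x \<in> closure S" unfolding closure_sequential by (intro exI[of _ "\<lambda>n. c *\<^sub>C f n"]) auto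
qed

text \<open>The difference of the two vectors is orthogonal to \<open>L\<close> and lies in its closure, so it is
  orthogonal to itself.\<close>

lemma closure_eq_by_cinner:
  assumes "csubspace L" "z \<in> closure L" "z' \<in> closure L"
    and "\<And>w. w \<in> L \<Longrightarrow> cinner w z = cinner w (z'::'a::complex_inner)"
  shows "z = z'"
proof -
  have "z - z' \<in> closure L"
    using csubspace_diff[OF csubspace_closure] assms by blast
  then obtain f where f: "\<And>n. f n \<in> L" "f \<longlonglongrightarrow> z - z'"
    unfolding closure_sequential by blast
  have "(\<lambda>n. cinner (f n) (z - z')) \<longlonglongrightarrow> cinner (z - z') (z - z')"
    by (intro tendsto_cinner f tendsto_const)
  moreover have "cinner (f n) (z - z') = 0" for n
    using assms(4)[OF f(1)] by (simp add: cinner_diff_right)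
  ultimately have "cinner (z - z') (z - z') = 0"
    by (simp add: LIMSEQ_const_iff)
  then show ?thesis by (simp add: cinner_self)
qed

lemma linear_coeff_zero:
  fixes a b :: real
  assumes "\<And>t. 0 \<le> t\<^sup>2 * a + 2 * t * b"
  shows "b = 0"
proof (rule ccontr)
  assume "b \<noteq> 0"
  have a: "0 \<le> a" using assms[of 1] assms[of "-1"] by simp
  \<comment> \<open>the minimizer \<open>- b / a\<close>, moved so that \<open>a = 0\<close> is covered as well\<close>
  define t where "t = - b / (a + 1)"
  have "b = - (t * (a + 1))" using a by (simp add: t_def)
  then have "t\<^sup>2 * a + 2 * t * b = t\<^sup>2 * a + 2 * t * (- (t * (a + 1)))"
    by (rule arg_cong)
  also have "\<dots> = - (t\<^sup>2 * (a + 2))"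
    by (simp add: power2_eq_square algebra_simps)
  also have "\<dots> < 0" using a \<open>b \<noteq> 0\<close> by (simp add: t_def)
  finally show False using assms[of t] by simp
qed

text \<open>
  The representing vector is the limit of the images of a minimizing sequence of
  \<open>\<parallel>A x\<parallel>\<^sup>2 - 2 Re l(x)\<close>. The parallelogram law is applied to the images: these form a Cauchy
  sequence even where the arguments do not.
\<close>

lemma riesz_representation:
  fixes A :: "'b::complex_inner \<Rightarrow> 'a::chilbert_space" and l :: "'b \<Rightarrow> complex"
  assumes E: "csubspace E" and A: "clinear_on E A" and l: "clinear_on E l"
    and bound: "\<And>x. x \<in> E \<Longrightarrow> cmod (l x) \<le> c * norm (A x)"
  shows "\<exists>z\<in>closure (A ` E). \<forall>x\<in>E. l x = cinner (A x) z"
proof -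
  define Q where "Q x = (norm (A x))\<^sup>2 - 2 * Re (l x)" for x
  have low: "- c\<^sup>2 \<le> Q x" if "x \<in> E" for x
  proof -
    have "Re (l x) \<le> c * norm (A x)"
      using bound[OF that] complex_Re_le_cmod[of "l x"] by linarith
    moreover have "0 \<le> (norm (A x) - c)\<^sup>2" by simp
    ultimately show ?thesis by (simp add: Q_def power2_diff mult.commute)
  qed
  define m where "m = Inf (Q ` E)"
  have bdd: "bdd_below (Q ` E)" using low by (rule bdd_belowI2)
  have ne: "Q ` E \<noteq> {}" using csubspace_0[OF E] by blast
  have m_le: "m \<le> Q x" if "x \<in> E" for x
    unfolding m_def using cINF_lower[OF bdd that] .
  have "\<exists>x\<in>E. Q x < m + 1 / real (Suc n)" for n
    using cInf_lessD[OF ne, of "m + 1 / real (Suc n)"] unfolding m_def by auto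
  then obtain f where f: "\<And>n. f n \<in> E" "\<And>n. Q (f n) < m + 1 / real (Suc n)"
    by metis
  have gap: "(norm (A (f i) - A (f j)))\<^sup>2 \<le> 2 / real (Suc i) + 2 / real (Suc j)" for i j
  proof -
    define h where "h = (1/2) *\<^sub>R (f i + f j)"
    have "h \<in> E" unfolding h_def by (intro csubspace_scaleR csubspace_add E f)
    have Ah: "A h = (1/2) *\<^sub>R (A (f i) + A (f j))"
      unfolding h_def using clinear_on_scaleR[OF A] clinear_on_add[OF A] csubspace_add[OF E] f by simp
    have lh: "l h = (1/2) *\<^sub>R (l (f i) + l (f j))"
      unfolding h_def using clinear_on_scaleR[OF l] clinear_on_add[OF l] csubspace_add[OF E] f by simp
    have "(norm (A (f i) - A (f j)))\<^sup>2 = 2 * Q (f i) + 2 * Q (f j) - 4 * Q h"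
      by (simp add: Q_def Ah lh norm_sq_diff norm_sq_add power_mult_distrib cinner_simps
          field_simps)
    then show ?thesis using f(2)[of i] f(2)[of j] m_le[OF \<open>h \<in> E\<close>] by linarith
  qed
  have "Cauchy (\<lambda>n. A (f n))"
  proof (rule metric_CauchyI)
    fix e :: real assume "0 < e"
    then obtain N where N: "4 / real (Suc N) < e\<^sup>2"
      using nat_approx_posE[of "e\<^sup>2 / 4"] by (auto simp: field_simps)
    have "dist (A (f i)) (A (f j)) < e" if "i \<ge> N" "j \<ge> N" for i j
    proof -
      have "2 / real (Suc i) \<le> 2 / real (Suc N)" "2 / real (Suc j) \<le> 2 / real (Suc N)"
        using that by (auto simp: field_simps)
      then have "(norm (A (f i) - A (f j)))\<^sup>2 < e\<^sup>2" using gap[of i j] N by linarith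
      then show ?thesis using \<open>0 < e\<close> using power2_less_imp_less[of "norm (A (f i) - A (f j))" e]
        by (simp add: dist_norm)
    qed
    then show "\<exists>M. \<forall>m\<ge>M. \<forall>n\<ge>M. dist (A (f m)) (A (f n)) < e" by blast
  qed
  then obtain z where z: "(\<lambda>n. A (f n)) \<longlonglongrightarrow> z"
    using Cauchy_convergent_iff convergent_def by blast
  have re: "Re (l x) = Re (cinner (A x) z)" if x: "x \<in> E" for x
  proof -
    have "0 \<le> t\<^sup>2 * (norm (A x))\<^sup>2 + 2 * t * (Re (cinner (A x) z) - Re (l x))" for t :: real
    proof -
      have "- (1 / real (Suc n)) \<le>
          t\<^sup>2 * (norm (A x))\<^sup>2 + 2 * t * (Re (cinner (A x) (A (f n))) - Re (l x))" for n
      proof -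
        have "f n + t *\<^sub>R x \<in> E" by (intro csubspace_add csubspace_scaleR E f x)
        then have "m \<le> Q (f n + t *\<^sub>R x)" by (rule m_le)
        also have "\<dots> = Q (f n) + t\<^sup>2 * (norm (A x))\<^sup>2
            + 2 * t * (Re (cinner (A x) (A (f n))) - Re (l x))"
          using clinear_on_add[OF A f(1) csubspace_scaleR[OF E x]] clinear_on_scaleR[OF A x]
            clinear_on_add[OF l f(1) csubspace_scaleR[OF E x]] clinear_on_scaleR[OF l x]
          by (simp add: Q_def norm_sq_add cinner_simps power_mult_distrib algebra_simps
              Re_cinner_commute[of "A (f n)" "A x"])
        finally show ?thesis using f(2)[of n] by linarith
      qed
      moreover have "(\<lambda>n. - (1 / real (Suc n))) \<longlonglongrightarrow> 0"
        using tendsto_minus[OF LIMSEQ_Suc[OF lim_const_over_n[of 1]]] by simp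
      moreover have "(\<lambda>n. t\<^sup>2 * (norm (A x))\<^sup>2 + 2 * t * (Re (cinner (A x) (A (f n))) - Re (l x)))
          \<longlonglongrightarrow> t\<^sup>2 * (norm (A x))\<^sup>2 + 2 * t * (Re (cinner (A x) z) - Re (l x))"
        by (intro tendsto_intros tendsto_cinner z)
      ultimately show ?thesis by (blast intro: LIMSEQ_le)
    qed
    then have "Re (cinner (A x) z) - Re (l x) = 0" by (rule linear_coeff_zero)
    then show ?thesis by simp
  qed
  have "l x = cinner (A x) z" if x: "x \<in> E" for x
  proof (rule complex_eq_by_rotation)
    show "Re (\<i> * l x) = Re (\<i> * cinner (A x) z)"
      using re[OF csubspace_scaleC[OF E x], of \<i>] clinear_on_scaleC[OF A x, of \<i>]
        clinear_on_scaleC[OF l x, of \<i>]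
      by (simp add: cinner_scaleC_left scaleC_complex_def)
  qed (rule re[OF x])
  moreover have "z \<in> closure (A ` E)"
    unfolding closure_sequential using z f(1) by (intro exI[of _ "\<lambda>n. A (f n)"]) simp
  ultimately show ?thesis by blast
qed

lemma bounded_clinear_bounded: "bounded_clinear T \<Longrightarrow> bounded_linear T"
  and bounded_clinear_add: "bounded_clinear T \<Longrightarrow> T (x + y) = T x + T y"
  and bounded_clinear_diff: "bounded_clinear T \<Longrightarrow> T (x - y) = T x - T y"
  and bounded_clinear_minus: "bounded_clinear T \<Longrightarrow> T (- x) = - T x"
  and bounded_clinear_zero: "bounded_clinear T \<Longrightarrow> T 0 = 0"
  and bounded_clinear_scaleR: "bounded_clinear T \<Longrightarrow> T (r *\<^sub>R x) = r *\<^sub>R T x"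
  and bounded_clinear_scaleC: "bounded_clinear T \<Longrightarrow> T (c *\<^sub>C x) = c *\<^sub>C T x"
  and bounded_clinear_tendsto: "bounded_clinear T \<Longrightarrow> (f \<longlongrightarrow> x) F \<Longrightarrow> ((\<lambda>i. T (f i)) \<longlongrightarrow> T x) F"
  unfolding bounded_clinear_def
  by (auto simp: linear_simps bounded_linear.tendsto)

lemma bounded_clinear_clinear_on: "bounded_clinear T \<Longrightarrow> clinear_on E T"
  by (simp add: clinear_on_def bounded_clinear_add bounded_clinear_scaleC)

lemma bounded_clinearI:
  assumes "\<And>x y. T (x + y) = T x + T y" "\<And>c x. T (c *\<^sub>C x) = c *\<^sub>C T x"
    and "\<And>x. norm (T x) \<le> K * norm x"
  shows "bounded_clinear T"
  unfolding bounded_clinear_def using assms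
  by (auto intro!: bounded_linear_intro[where K = K] simp: scaleR_scaleC mult.commute)

text \<open>
  This is Douglas' factorization lemma in adjoint form: the norm bound says \<open>B = K A\<close> for an
  operator \<open>K\<close> of norm at most \<open>c\<close> on the closure of \<open>A E\<close>, and \<open>Z\<close> is
  the adjoint of \<open>K\<close>. With \<open>A\<close> the identity it yields adjoints and orthogonal
  projections.
\<close>

lemma douglas_factorization:
  fixes A :: "'b::complex_inner \<Rightarrow> 'a::chilbert_space" and B :: "'b \<Rightarrow> 'c::complex_inner"
  assumes E: "csubspace E" and A: "clinear_on E A" and B: "clinear_on E B"
    and bound: "\<And>x. x \<in> E \<Longrightarrow> norm (B x) \<le> c * norm (A x)" and c: "0 \<le> c"
  obtains Z where "bounded_clinear Z" "\<And>x y. x \<in> E \<Longrightarrow> cinner (B x) y = cinner (A x) (Z y)"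
    "\<And>y. Z y \<in> closure (A ` E)" "\<And>y. norm (Z y) \<le> c * norm y"
proof -
  let ?L = "A ` E"
  have L: "csubspace ?L" by (rule csubspace_image[OF E A])
  have "\<exists>z\<in>closure ?L. \<forall>x\<in>E. cinner (B x) y = cinner (A x) z" for y
  proof (rule riesz_representation[OF E A, where c = "c * norm y"])
    show "clinear_on E (\<lambda>x. cinner (B x) y)"
      using B by (auto simp: clinear_on_def cinner_add_left cinner_scaleC_left scaleC_complex_def)
  next
    fix x assume "x \<in> E"
    have "cmod (cinner (B x) y) \<le> norm (B x) * norm y" by (rule norm_cinner_le)
    also have "\<dots> \<le> (c * norm (A x)) * norm y"
      by (rule mult_right_mono[OF bound[OF \<open>x \<in> E\<close>]]) simp
    finally show "cmod (cinner (B x) y) \<le> c * norm y * norm (A x)" by (simp add: mult_ac)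
  qed
  then obtain Z where Zcl: "\<And>y. Z y \<in> closure ?L"
    and Z: "\<And>x y. x \<in> E \<Longrightarrow> cinner (B x) y = cinner (A x) (Z y)"
    by metis
  have add: "Z (y + y') = Z y + Z y'" for y y'
    using Z[symmetric]
    by (intro closure_eq_by_cinner[OF L Zcl csubspace_add[OF csubspace_closure[OF L] Zcl Zcl]])
      (auto simp: cinner_add_right)
  have scale: "Z (a *\<^sub>C y) = a *\<^sub>C Z y" for a y
    using Z[symmetric]
    by (intro closure_eq_by_cinner[OF L Zcl csubspace_scaleC[OF csubspace_closure[OF L] Zcl]])
      (auto simp: cinner_scaleC_right)
  have norm: "norm (Z y) \<le> c * norm y" for y
  proof -
    obtain g where g: "\<And>n. g n \<in> ?L" "g \<longlonglongrightarrow> Z y"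
      using Zcl[of y] unfolding closure_sequential by blast
    have "Re (cinner (g n) (Z y)) \<le> c * norm y * norm (g n)" for n
    proof -
      obtain x where x: "x \<in> E" "g n = A x" using g(1) by blast
      have "Re (cinner (g n) (Z y)) = Re (cinner (B x) y)" using Z x by simp
      also have "\<dots> \<le> norm (B x) * norm y" by (rule Re_cinner_le)
      also have "\<dots> \<le> (c * norm (A x)) * norm y"
        by (rule mult_right_mono[OF bound[OF x(1)]]) simp
      finally show ?thesis using x by (simp add: mult_ac)
    qed
    then have "Re (cinner (Z y) (Z y)) \<le> c * norm y * norm (Z y)"
      by (intro LIMSEQ_le[OF tendsto_Re[OF tendsto_cinner[OF g(2) tendsto_const]]
            tendsto_mult_left[OF tendsto_norm[OF g(2)]]]) auto
    then have "norm (Z y) * norm (Z y) \<le> (c * norm y) * norm (Z y)"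
      by (simp add: norm_sq_cinner[symmetric] power2_eq_square)
    then show ?thesis using c
      by (cases "Z y = 0") auto
  qed
  have "bounded_clinear Z" by (rule bounded_clinearI[OF add scale norm])
  then show thesis using that Z Zcl norm by blast
qed

lemma adjoint_exists:
  fixes W :: "'a::chilbert_space \<Rightarrow> 'b::complex_inner"
  assumes "bounded_clinear W"
  obtains W' where "bounded_clinear W'" "\<And>x y. cinner (W x) y = cinner x (W' y)"
proof -
  obtain K where K: "0 \<le> K" "\<And>x. norm (W x) \<le> K * norm x"
    using bounded_linear.nonneg_bounded[OF bounded_clinear_bounded[OF assms]]
    by (metis mult.commute)
  obtain Z where "bounded_clinear Z" "\<And>x y. x \<in> UNIV \<Longrightarrow> cinner (W x) y = cinner x (Z y)"
    by (rule douglas_factorization[OF csubspace_UNIV, of "\<lambda>x. x" W K])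
      (use K assms in \<open>auto simp: clinear_on_def bounded_clinear_add bounded_clinear_scaleC\<close>)
  then show thesis using that by blast
qed

lemma bounded_selfadjoint_clinear: "bounded_selfadjoint T \<Longrightarrow> bounded_clinear T"
  by (simp add: bounded_selfadjoint_def bounded_clinear_def)

lemma bounded_selfadjoint_cinner: "bounded_selfadjoint T \<Longrightarrow> cinner (T x) y = cinner x (T y)"
  by (simp add: bounded_selfadjoint_def)

lemma bounded_selfadjointI:
  "bounded_clinear T \<Longrightarrow> (\<And>x y. cinner (T x) y = cinner x (T y)) \<Longrightarrow> bounded_selfadjoint T"
  by (simp add: bounded_selfadjoint_def bounded_clinear_def)

lemma orthogonal_projection_exists:
  fixes S :: "'a::chilbert_space set"
  assumes "closed_csubspace S"
  obtains P where "bounded_selfadjoint P" "\<And>x. P x \<in> S" "\<And>x. x \<in> S \<Longrightarrow> P x = x"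
    "\<And>x. norm (P x) \<le> norm x"
proof -
  have S: "csubspace S" "closure S = S" using assms by (auto simp: closed_csubspace_def)
  have id: "clinear_on S (\<lambda>x. x)" by (simp add: clinear_on_def)
  obtain P where P: "bounded_clinear P" "\<And>x y. x \<in> S \<Longrightarrow> cinner x y = cinner x (P y)"
    "\<And>y. P y \<in> closure ((\<lambda>x. x) ` S)" "\<And>y. norm (P y) \<le> 1 * norm y"
    by (rule douglas_factorization[OF S(1) id id, of 1]) (simp, simp, blast)
  have PS: "P y \<in> S" for y using P(3) S(2) by simp
  have "cinner (P x) y = cinner x (P y)" for x y
  proof -
    have "cinner (P x) y = cinner (P x) (P y)" using P(2)[OF PS] .
    also have "\<dots> = cnj (cinner (P y) (P x))" by (rule cinner_commute)
    also have "\<dots> = cnj (cinner (P y) x)" using P(2)[OF PS, of y x] by simp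
    also have "\<dots> = cinner x (P y)" by (rule cinner_commute[symmetric])
    finally show ?thesis .
  qed
  then have "bounded_selfadjoint P" using P(1) by (intro bounded_selfadjointI)
  moreover have "P x = x" if "x \<in> S" for x
    using that PS S(2) P(2)[symmetric]
    by (intro closure_eq_by_cinner[OF S(1)]) auto
  ultimately show thesis using that PS P(4) by simp
qed

section \<open>Bounded self-adjoint operators and their forms\<close>

lemma bsa_add: "bounded_selfadjoint A \<Longrightarrow> bounded_selfadjoint B \<Longrightarrow> bounded_selfadjoint (\<lambda>x. A x + B x)"
  by (auto simp: bounded_selfadjoint_def bounded_linear_add scaleC_add_right cinner_simps)

lemma bsa_diff: "bounded_selfadjoint A \<Longrightarrow> bounded_selfadjoint B \<Longrightarrow> bounded_selfadjoint (\<lambda>x. A x - B x)"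
  by (auto simp: bounded_selfadjoint_def bounded_linear_sub scaleC_diff_right cinner_simps)

lemma bsa_minus: "bounded_selfadjoint A \<Longrightarrow> bounded_selfadjoint (\<lambda>x. - A x)"
  by (auto simp: bounded_selfadjoint_def bounded_linear_minus scaleC_minus_right cinner_simps)

lemma bsa_scaleR: "bounded_selfadjoint A \<Longrightarrow> bounded_selfadjoint (\<lambda>x. r *\<^sub>R A x)"
  by (auto simp: bounded_selfadjoint_def bounded_linear_const_scaleR scaleC_scaleR cinner_simps)

lemma bsa_id: "bounded_selfadjoint (\<lambda>x. x)"
  by (simp add: bounded_selfadjoint_def bounded_linear_ident)

lemma bsa_zero: "bounded_selfadjoint (\<lambda>x. 0)"
  by (simp add: bounded_selfadjoint_def)

lemma bsa_conj: "bounded_selfadjoint A \<Longrightarrow> bounded_selfadjoint V \<Longrightarrow> bounded_selfadjoint (\<lambda>x. V (A (V x)))"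
  by (auto simp: bounded_selfadjoint_def intro: bounded_linear_compose)

lemma bsa_square: "bounded_selfadjoint A \<Longrightarrow> bounded_selfadjoint (\<lambda>x. A (A x))"
  by (auto simp: bounded_selfadjoint_def intro: bounded_linear_compose)

lemmas bsa_intros = bsa_add bsa_diff bsa_minus bsa_scaleR bsa_id bsa_zero

definition qform :: "('a::complex_inner \<Rightarrow> 'a) \<Rightarrow> 'a \<Rightarrow> real" where
  "qform A x = Re (cinner (A x) x)"

lemma Re_cinner_swap:
  "bounded_selfadjoint A \<Longrightarrow> Re (cinner (A x) y) = Re (cinner (A y) x)"
  by (metis bounded_selfadjoint_cinner Re_cinner_commute)

lemma qform_add:
  assumes "bounded_selfadjoint A"
  shows "qform A (x + y) = qform A x + 2 * Re (cinner (A x) y) + qform A y"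
  using Re_cinner_swap[OF assms, of y x]
  by (simp add: qform_def bounded_clinear_add[OF bounded_selfadjoint_clinear[OF assms]] cinner_simps)

lemma qform_diff:
  assumes "bounded_selfadjoint A"
  shows "qform A (x - y) = qform A x - 2 * Re (cinner (A x) y) + qform A y"
  using Re_cinner_swap[OF assms, of y x]
  by (simp add: qform_def bounded_clinear_diff[OF bounded_selfadjoint_clinear[OF assms]] cinner_simps)

lemma qform_scaleR:
  assumes "bounded_selfadjoint A"
  shows "qform A (r *\<^sub>R x) = r\<^sup>2 * qform A x"
  by (simp add: qform_def bounded_clinear_scaleR[OF bounded_selfadjoint_clinear[OF assms]]
      cinner_simps power2_eq_square)

lemma qform_kernel:
  assumes "bounded_selfadjoint A" "A s = 0"
  shows "qform A (x - s) = qform A x"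
  using qform_diff[OF assms(1), of x s] Re_cinner_swap[OF assms(1), of x s] assms(2)
  by (simp add: qform_def)

text \<open>Vanishing of a nonnegative form at \<open>x\<close> is a minimum there, so the derivative vanishes too.\<close>

lemma qform_zero_imp_kernel:
  assumes "bounded_selfadjoint A" "\<And>y. 0 \<le> qform A y" "qform A x = 0"
  shows "A x = 0"
proof -
  have "Re (cinner (A x) y) = 0" for y
  proof (rule linear_coeff_zero)
    fix t
    have "0 \<le> qform A (x + t *\<^sub>R y)" by (rule assms)
    then show "0 \<le> t\<^sup>2 * qform A y + 2 * t * Re (cinner (A x) y)"
      by (simp add: qform_add[OF assms(1)] qform_scaleR[OF assms(1)] assms(3) cinner_simps)
  qed
  from this[of "A x"] show ?thesis by (simp add: norm_sq_cinner[symmetric])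
qed

lemma op_le_qform: "op_le A B \<longleftrightarrow> (\<forall>x. qform A x \<le> qform B x)"
  by (simp add: op_le_def qform_def)

lemma op_le_antisym:
  assumes "bounded_selfadjoint A" "bounded_selfadjoint B" "op_le A B" "op_le B A"
  shows "A = B"
proof
  fix x
  have q: "qform (\<lambda>x. A x - B x) y = 0" for y
    using assms(3,4) unfolding op_le_def qform_def
    by (simp add: cinner_simps antisym)
  have "(\<lambda>x. A x - B x) x = 0"
    by (rule qform_zero_imp_kernel[OF bsa_diff[OF assms(1,2)]]) (simp_all only: q order_refl)
  then show "A x = B x" by simp
qed

text \<open>
  For self-adjoint \<open>T\<close> this is the form of \<open>I - T\<^sup>2\<close>.
\<close>

definition norm_defect :: "('a::complex_inner \<Rightarrow> 'a) \<Rightarrow> 'a \<Rightarrow> real" where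
  "norm_defect T x = (norm x)\<^sup>2 - (norm (T x))\<^sup>2"

text \<open>
  The infimum of the left-hand side over \<open>u + v = x\<close> is the form of the parallel sum of
  \<open>I + T\<close> and \<open>I - T\<close>; completing the square shows that it is half the form of
  \<open>I - T\<^sup>2\<close>.
\<close>

lemma parallel_sum_identity:
  assumes T: "bounded_selfadjoint T"
  shows "(norm u)\<^sup>2 + qform T u + ((norm v)\<^sup>2 - qform T v)
    = norm_defect T (u + v) / 2 + (norm (u - v + T (u + v)))\<^sup>2 / 2"
proof -
  have "(norm (u - v + T (u + v)))\<^sup>2
      = (norm (u - v))\<^sup>2 + 2 * Re (cinner (u - v) (T (u + v))) + (norm (T (u + v)))\<^sup>2"
    by (rule norm_sq_add)
  moreover have "Re (cinner (u - v) (T (u + v))) = qform T u - qform T v"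
    using Re_cinner_swap[OF T, of u v] Re_cinner_commute[of "T u" u] Re_cinner_commute[of "T u" v]
      Re_cinner_commute[of "T v" u] Re_cinner_commute[of "T v" v]
    by (simp add: qform_def bounded_clinear_add[OF bounded_selfadjoint_clinear[OF T]] cinner_simps)
  ultimately show ?thesis
    by (simp add: norm_defect_def norm_sq_add norm_sq_diff field_simps)
qed

lemma parallel_sum_minimizer:
  assumes T: "bounded_selfadjoint T"
  obtains u v where "x = u + v"
    "(norm u)\<^sup>2 + qform T u + ((norm v)\<^sup>2 - qform T v) = norm_defect T x / 2"
proof
  let ?u = "(1/2) *\<^sub>R (x - T x)" and ?v = "(1/2) *\<^sub>R (x + T x)"
  have "?u + ?v = (1/2) *\<^sub>R (x + x)" unfolding scaleR_add_right[symmetric] by simp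
  then have uv: "?u + ?v = x" by (simp add: scaleR_2[symmetric])
  have "?u - ?v = (1/2) *\<^sub>R (- (T x + T x))" unfolding scaleR_diff_right[symmetric] by simp
  then have "?u - ?v = - T x" by (simp add: scaleR_2[symmetric])
  then show "(norm ?u)\<^sup>2 + qform T ?u + ((norm ?v)\<^sup>2 - qform T ?v) = norm_defect T x / 2"
    using parallel_sum_identity[OF T, of ?u ?v] uv by simp
  show "x = ?u + ?v" using uv by simp
qed

lemma contraction_of_form_bounds:
  assumes T: "bounded_selfadjoint T" and "\<And>x. \<bar>qform T x\<bar> \<le> (norm x)\<^sup>2"
  shows "norm (T x) \<le> norm x"
proof -
  obtain u v where uv: "x = u + v"
    "(norm u)\<^sup>2 + qform T u + ((norm v)\<^sup>2 - qform T v) = norm_defect T x / 2"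
    by (rule parallel_sum_minimizer[OF T])
  then have "0 \<le> norm_defect T x"
    using assms(2)[of u] assms(2)[of v] by linarith
  then show ?thesis by (simp add: norm_defect_def abs_le_square_iff[symmetric])
qed

lemma form_bounds_of_contraction:
  assumes "\<And>x. norm (T x) \<le> norm (x::'a::complex_inner)"
  shows "\<bar>qform T x\<bar> \<le> (norm x)\<^sup>2"
proof -
  have "\<bar>qform T x\<bar> \<le> cmod (cinner (T x) x)" unfolding qform_def by (rule abs_Re_le_cmod)
  also have "\<dots> \<le> norm (T x) * norm x" by (rule norm_cinner_le)
  also have "\<dots> \<le> norm x * norm x" by (rule mult_right_mono[OF assms]) simp
  finally show ?thesis by (simp add: power2_eq_square)
qed

section \<open>Square roots of positive operators\<close>

text \<open>
  For a contraction \<open>X\<close> the iteration converges to the solution \<open>L\<close> of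
  \<open>(I - L)\<^sup>2 = I - X\<close>, because it is dominated in norm by the same iteration for the
  number \<open>1\<close>.
\<close>

fun sqrt_iter :: "('a::complex_inner \<Rightarrow> 'a) \<Rightarrow> nat \<Rightarrow> 'a \<Rightarrow> 'a" where
  "sqrt_iter X 0 x = 0"
| "sqrt_iter X (Suc n) x = (1/2) *\<^sub>R (X x + sqrt_iter X n (sqrt_iter X n x))"

fun sqrt_bound :: "nat \<Rightarrow> real" where
  "sqrt_bound 0 = 0"
| "sqrt_bound (Suc n) = (1 + (sqrt_bound n)\<^sup>2) / 2"

lemma sqrt_bound_range: "0 \<le> sqrt_bound n \<and> sqrt_bound n \<le> 1"
proof (induction n)
  case (Suc n)
  then have "(sqrt_bound n)\<^sup>2 \<le> 1" by (simp add: power_le_one)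
  then show ?case by simp
qed simp

lemma sqrt_bound_mono: "incseq sqrt_bound"
proof (rule incseq_SucI)
  fix n
  have "0 \<le> (sqrt_bound n - 1)\<^sup>2" by simp
  then show "sqrt_bound n \<le> sqrt_bound (Suc n)" by (simp add: power2_diff)
qed

lemma sqrt_iter_bsa: "bounded_selfadjoint X \<Longrightarrow> bounded_selfadjoint (sqrt_iter X n)"
proof (induction n)
  case 0
  have "sqrt_iter X 0 = (\<lambda>x. 0)" by auto
  then show ?case by (simp add: bsa_zero)
next
  case (Suc n)
  have "sqrt_iter X (Suc n) = (\<lambda>x. (1/2) *\<^sub>R (X x + sqrt_iter X n (sqrt_iter X n x)))" by auto
  then show ?case using Suc by (auto intro!: bsa_scaleR bsa_add bsa_square)
qed

lemma sqrt_iter_commute: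
  assumes "bounded_clinear C" "\<And>x. C (X x) = X (C x)"
  shows "C (sqrt_iter X n x) = sqrt_iter X n (C x)"
proof (induction n arbitrary: x)
  case 0
  show ?case by (simp add: bounded_clinear_zero[OF assms(1)])
next
  case (Suc n)
  then show ?case
    by (simp add: bounded_clinear_scaleR[OF assms(1)] bounded_clinear_add[OF assms(1)] assms(2))
qed

lemma sqrt_iter_norm:
  assumes X: "bounded_selfadjoint X" "\<And>x. norm (X x) \<le> norm x"
  shows "norm (sqrt_iter X n x) \<le> sqrt_bound n * norm x"
proof (induction n arbitrary: x)
  case 0
  show ?case by simp
next
  case (Suc n)
  have "norm (sqrt_iter X n (sqrt_iter X n x)) \<le> sqrt_bound n * norm (sqrt_iter X n x)"
    by (rule Suc)
  also have "\<dots> \<le> sqrt_bound n * (sqrt_bound n * norm x)"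
    using Suc sqrt_bound_range by (intro mult_left_mono) auto
  finally have "norm (X x + sqrt_iter X n (sqrt_iter X n x)) \<le> norm x + (sqrt_bound n)\<^sup>2 * norm x"
    using norm_triangle_ineq[of "X x" "sqrt_iter X n (sqrt_iter X n x)"] X(2)[of x]
    by (simp add: power2_eq_square mult.assoc)
  then show ?case
    by (simp only: sqrt_iter.simps norm_scaleR sqrt_bound.simps) (simp add: distrib_right)
qed

text \<open>
  The iterates commute, so \<open>Y\<^sub>n\<^sub>+\<^sub>1 Y\<^sub>n\<^sub>+\<^sub>1 - Y\<^sub>n Y\<^sub>n\<close> factors like a difference of two
  squares of numbers.
\<close>

lemma sqrt_iter_step:
  assumes X: "bounded_selfadjoint X" "\<And>x. norm (X x) \<le> norm x"
  shows "norm (sqrt_iter X (Suc n) x - sqrt_iter X n x) \<le> (sqrt_bound (Suc n) - sqrt_bound n) * norm x"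
proof (induction n arbitrary: x)
  case 0
  show ?case using X(2)[of x] by simp
next
  case (Suc n)
  let ?Y = "sqrt_iter X" and ?b = sqrt_bound
  have cl: "bounded_clinear (?Y k)" for k
    by (rule bounded_selfadjoint_clinear[OF sqrt_iter_bsa[OF X(1)]])
  have comm: "?Y k (X z) = X (?Y k z)" for k z
    by (rule sqrt_iter_commute[symmetric, OF bounded_selfadjoint_clinear[OF X(1)]]) simp
  have comm2: "?Y k (?Y j z) = ?Y j (?Y k z)" for k j z
    using sqrt_iter_commute[where C = "?Y k" and X = X] cl comm by blast
  define d where "d = ?Y (Suc n) x - ?Y n x"
  have d: "norm d \<le> (?b (Suc n) - ?b n) * norm x" unfolding d_def by (rule Suc)
  have "?Y (Suc (Suc n)) x - ?Y (Suc n) x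
      = (1/2) *\<^sub>R (?Y (Suc n) (?Y (Suc n) x) - ?Y n (?Y n x))"
    by (simp only: sqrt_iter.simps(2)[of X "Suc n" x] sqrt_iter.simps(2)[of X n x]
        scaleR_diff_right[symmetric]) simp
  also have "?Y (Suc n) (?Y (Suc n) x) - ?Y n (?Y n x) = ?Y (Suc n) d + ?Y n d"
    unfolding d_def bounded_clinear_diff[OF cl] by (simp only: comm2[of n "Suc n"]) simp
  finally have eq: "?Y (Suc (Suc n)) x - ?Y (Suc n) x = (1/2) *\<^sub>R (?Y (Suc n) d + ?Y n d)" .
  have "norm (?Y (Suc n) d + ?Y n d) \<le> ?b (Suc n) * norm d + ?b n * norm d"
    using norm_triangle_ineq[of "?Y (Suc n) d" "?Y n d"] sqrt_iter_norm[OF X, of "Suc n" d]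
      sqrt_iter_norm[OF X, of n d] by linarith
  also have "\<dots> = (?b (Suc n) + ?b n) * norm d" by (simp only: distrib_right)
  also have "\<dots> \<le> (?b (Suc n) + ?b n) * ((?b (Suc n) - ?b n) * norm x)"
    using sqrt_bound_range[of n] sqrt_bound_range[of "Suc n"] d by (intro mult_left_mono) auto
  also have "\<dots> = 2 * ((?b (Suc (Suc n)) - ?b (Suc n)) * norm x)"
    by (simp only: sqrt_bound.simps(2)[of "Suc n"] sqrt_bound.simps(2)[of n])
      (simp add: field_simps power2_eq_square)
  finally show ?case unfolding eq by simp
qed

lemma sqrt_iter_diff:
  assumes X: "bounded_selfadjoint X" "\<And>x. norm (X x) \<le> norm x" and "n \<le> m"
  shows "norm (sqrt_iter X m x - sqrt_iter X n x) \<le> (sqrt_bound m - sqrt_bound n) * norm x"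
  using \<open>n \<le> m\<close>
proof (induction m rule: dec_induct)
  case (step m)
  have "norm (sqrt_iter X (Suc m) x - sqrt_iter X n x)
      \<le> norm (sqrt_iter X (Suc m) x - sqrt_iter X m x) + norm (sqrt_iter X m x - sqrt_iter X n x)"
    using norm_triangle_ineq[of "sqrt_iter X (Suc m) x - sqrt_iter X m x"
        "sqrt_iter X m x - sqrt_iter X n x"] by (simp del: sqrt_iter.simps)
  also have "\<dots> \<le> (sqrt_bound (Suc m) - sqrt_bound m) * norm x + (sqrt_bound m - sqrt_bound n) * norm x"
    by (intro add_mono sqrt_iter_step[OF X] step.IH)
  finally show ?case by (simp only: distrib_right[symmetric]) simp
qed simp

lemma sqrt_one_minus:
  fixes X :: "'a::chilbert_space \<Rightarrow> 'a"
  assumes X: "bounded_selfadjoint X" "\<And>x. norm (X x) \<le> norm x"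
  obtains L where "bounded_selfadjoint L" "\<And>x. (L x) + (L x) = X x + L (L x)"
    "\<And>C x. bounded_clinear C \<Longrightarrow> (\<And>x. C (X x) = X (C x)) \<Longrightarrow> C (L x) = L (C x)"
proof -
  let ?Y = "sqrt_iter X"
  have conv: "Cauchy (\<lambda>n. ?Y n x)" for x
  proof (rule metric_CauchyI)
    fix e :: real assume "0 < e"
    have "Cauchy sqrt_bound"
      using incseq_bounded[OF sqrt_bound_mono, of 1] sqrt_bound_range sqrt_bound_mono
      by (metis Bseq_mono_convergent convergent_Cauchy incseq_def incseq_convergent)
    moreover have "0 < e / (norm x + 1)" using \<open>0 < e\<close> by (simp add: add_nonneg_pos)
    ultimately obtain M where
      M: "\<And>m n. m \<ge> M \<Longrightarrow> n \<ge> M \<Longrightarrow> dist (sqrt_bound m) (sqrt_bound n) < e / (norm x + 1)"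
      by (meson metric_CauchyD)
    have key: "norm (?Y m x - ?Y n x) < e" if "M \<le> n" "n \<le> m" for m n
    proof -
      have "norm (?Y m x - ?Y n x) \<le> (sqrt_bound m - sqrt_bound n) * norm x"
        by (rule sqrt_iter_diff[OF X \<open>n \<le> m\<close>])
      also have "\<dots> \<le> (e / (norm x + 1)) * norm x"
        using M[of m n] that by (intro mult_right_mono) (auto simp: dist_real_def)
      also have "\<dots> < e" using \<open>0 < e\<close> by (simp add: divide_less_eq add_nonneg_pos)
      finally show ?thesis .
    qed
    have "dist (?Y m x) (?Y n x) < e" if "m \<ge> M" "n \<ge> M" for m n
      using key[of n m] key[of m n] that
      by (cases "n \<le> m") (auto simp: dist_norm norm_minus_commute)
    then show "\<exists>M. \<forall>m\<ge>M. \<forall>n\<ge>M. dist (?Y m x) (?Y n x) < e" by blast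
  qed
  define L where "L x = lim (\<lambda>n. ?Y n x)" for x
  have L: "(\<lambda>n. ?Y n x) \<longlonglongrightarrow> L x" for x
    unfolding L_def using conv Cauchy_convergent_iff convergent_LIMSEQ_iff by blast
  have cl: "bounded_clinear (?Y k)" for k
    by (rule bounded_selfadjoint_clinear[OF sqrt_iter_bsa[OF X(1)]])
  have Ybound: "norm (?Y n x) \<le> norm x" for n x
    using sqrt_iter_norm[OF X, of n x] sqrt_bound_range[of n]
      mult_right_mono[of "sqrt_bound n" 1 "norm x"] by simp
  have add: "L (x + y) = L x + L y" for x y
    using LIMSEQ_unique[OF L[of "x + y"]] tendsto_add[OF L[of x] L[of y]]
    by (simp add: bounded_clinear_add[OF cl])
  have scale: "L (c *\<^sub>C x) = c *\<^sub>C L x" for c x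
    using LIMSEQ_unique[OF L[of "c *\<^sub>C x"]] bounded_linear.tendsto[OF bounded_linear_scaleC L[of x], of c]
    by (simp add: bounded_clinear_scaleC[OF cl])
  have norm: "norm (L x) \<le> 1 * norm x" for x
    using LIMSEQ_le_const2[OF tendsto_norm[OF L[of x]], of "norm x"] Ybound by auto
  have clL: "bounded_clinear L" by (rule bounded_clinearI[OF add scale norm])
  have sa: "cinner (L x) y = cinner x (L y)" for x y
  proof -
    have "cinner (?Y n x) y = cinner x (?Y n y)" for n
      by (rule bounded_selfadjoint_cinner[OF sqrt_iter_bsa[OF X(1)]])
    then show ?thesis
      using LIMSEQ_unique[OF tendsto_cinner[OF L[of x] tendsto_const[of y]]]
        tendsto_cinner[OF tendsto_const[of x] L[of y]] by simp
  qed
  have eq: "L x + L x = X x + L (L x)" for x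
  proof -
    have "(\<lambda>n. ?Y n (?Y n x - L x)) \<longlonglongrightarrow> 0"
    proof (rule Lim_null_comparison)
      show "\<forall>\<^sub>F n in sequentially. norm (?Y n (?Y n x - L x)) \<le> norm (?Y n x - L x)"
        using Ybound by simp
      show "(\<lambda>n. norm (?Y n x - L x)) \<longlonglongrightarrow> 0"
        using L[of x] by (simp add: LIM_zero_iff tendsto_norm_zero_iff)
    qed
    from tendsto_add[OF this L[of "L x"]]
    have "(\<lambda>n. ?Y n (?Y n x)) \<longlonglongrightarrow> L (L x)" by (simp add: bounded_clinear_diff[OF cl])
    then have "(\<lambda>n. ?Y (Suc n) x) \<longlonglongrightarrow> (1/2) *\<^sub>R (X x + L (L x))"
      unfolding sqrt_iter.simps by (intro tendsto_intros)
    then have "L x = (1/2) *\<^sub>R (X x + L (L x))"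
      by (rule LIMSEQ_unique[OF LIMSEQ_Suc[OF L[of x]]])
    from arg_cong[OF this, of "\<lambda>z. z + z"] show ?thesis
      by (simp flip: scaleR_left_distrib)
  qed
  have "C (L x) = L (C x)" if C: "bounded_clinear C" "\<And>x. C (X x) = X (C x)" for C x
    using LIMSEQ_unique[OF bounded_clinear_tendsto[OF C(1) L[of x]]] L[of "C x"]
    by (simp add: sqrt_iter_commute[where C = C and X = X, OF C])
  then show thesis using that bounded_selfadjointI[OF clL sa] eq by blast
qed

text \<open>
  After division by a norm bound \<open>c\<close> of \<open>R\<close>, the complement \<open>X = I - R / c\<close> is a
  contraction. The root commutes with whatever commutes with \<open>R\<close>, as a limit of polynomials in
  \<open>R\<close>.
\<close>

lemma positive_sqrt_exists:
  fixes R :: "'a::chilbert_space \<Rightarrow> 'a"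
  assumes R: "bounded_selfadjoint R" "\<And>x. 0 \<le> qform R x"
  obtains V where "bounded_selfadjoint V" "\<And>x. V (V x) = R x"
    "\<And>C x. bounded_clinear C \<Longrightarrow> (\<And>x. C (R x) = R (C x)) \<Longrightarrow> C (V x) = V (C x)"
proof -
  obtain c where c: "0 < c" "\<And>x. norm (R x) \<le> c * norm x"
    using bounded_linear.pos_bounded[OF bounded_clinear_bounded[OF bounded_selfadjoint_clinear[OF R(1)]]]
    by (metis mult.commute)
  define X where "X x = x - (1/c) *\<^sub>R R x" for x
  have X: "bounded_selfadjoint X" unfolding X_def[abs_def] by (intro bsa_intros R)
  have qX: "qform X x = (norm x)\<^sup>2 - qform R x / c" for x
    by (simp add: X_def qform_def cinner_simps norm_sq_cinner)
  have Xn: "norm (X x) \<le> norm x" for x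
  proof (rule contraction_of_form_bounds[OF X])
    fix x
    have "qform R x \<le> norm (R x) * norm x" unfolding qform_def by (rule Re_cinner_le)
    also have "\<dots> \<le> (c * norm x) * norm x" by (rule mult_right_mono[OF c(2)]) simp
    finally have "qform R x / c \<le> (norm x)\<^sup>2" using c(1) by (simp add: field_simps power2_eq_square)
    moreover have "0 \<le> qform R x / c" using R(2) c(1) by simp
    ultimately show "\<bar>qform X x\<bar> \<le> (norm x)\<^sup>2" by (simp add: qX)
  qed
  obtain L where L: "bounded_selfadjoint L" "\<And>x. (L x) + (L x) = X x + L (L x)"
    "\<And>C x. bounded_clinear C \<Longrightarrow> (\<And>x. C (X x) = X (C x)) \<Longrightarrow> C (L x) = L (C x)"
    by (rule sqrt_one_minus[OF X Xn]) blast
  define V where "V x = sqrt c *\<^sub>R (x - L x)" for x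
  have "bounded_selfadjoint V" unfolding V_def[abs_def] by (intro bsa_intros L)
  moreover have "V (V x) = R x" for x
  proof -
    note clL = bounded_selfadjoint_clinear[OF L(1)]
    have "V (V x) = c *\<^sub>R (x - L x - (L x - L (L x)))"
      using c(1) by (simp add: V_def bounded_clinear_scaleR[OF clL] bounded_clinear_diff[OF clL]
          scaleR_diff_right)
    also have "x - L x - (L x - L (L x)) = x - (L x + L x) + L (L x)" by simp
    also have "\<dots> = (1/c) *\<^sub>R R x" unfolding L(2) by (simp add: X_def)
    finally show ?thesis using c(1) by simp
  qed
  moreover have "C (V x) = V (C x)" if C: "bounded_clinear C" "\<And>x. C (R x) = R (C x)" for C x
  proof -
    have "C (X x) = X (C x)" for x
      by (simp add: X_def bounded_clinear_diff[OF C(1)] bounded_clinear_scaleR[OF C(1)] C(2))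
    then show ?thesis
      by (simp add: V_def bounded_clinear_diff[OF C(1)] bounded_clinear_scaleR[OF C(1)] L(3)[OF C(1)])
  qed
  ultimately show thesis using that by blast
qed

lemma norm_sqrt:
  assumes "bounded_selfadjoint V" "\<And>x. V (V x) = R x"
  shows "(norm (V x))\<^sup>2 = qform R x"
  by (simp add: norm_sq_cinner qform_def bounded_selfadjoint_cinner[OF assms(1)] assms(2)
      flip: Re_cinner_commute[of x])

section \<open>Contractive self-adjoint extensions of a symmetric contraction\<close>

definition symmetric_contraction :: "'a::complex_inner graph \<Rightarrow> bool" where
  "symmetric_contraction T \<longleftrightarrow> closed_csubspace T \<and> (\<forall>(x, y)\<in>T. norm y \<le> norm x) \<and>
     (\<forall>(x, y)\<in>T. \<forall>(x', y')\<in>T. cinner y x' = cinner x y')"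

lemma symmetric_contractionD:
  assumes "symmetric_contraction T"
  shows "csubspace T" "closed T" "\<And>x y. (x, y) \<in> T \<Longrightarrow> norm y \<le> norm x"
    "\<And>x y x' y'. (x, y) \<in> T \<Longrightarrow> (x', y') \<in> T \<Longrightarrow> cinner y x' = cinner x y'"
  using assms unfolding symmetric_contraction_def closed_csubspace_def by blast+

lemma csubspace_pair:
  assumes "csubspace (T :: ('a::complex_inner \<times> 'a) set)"
  shows "(0, 0) \<in> T" "\<And>x y x' y'. (x, y) \<in> T \<Longrightarrow> (x', y') \<in> T \<Longrightarrow> (x + x', y + y') \<in> T"
    "\<And>x y x' y'. (x, y) \<in> T \<Longrightarrow> (x', y') \<in> T \<Longrightarrow> (x - x', y - y') \<in> T"
    "\<And>c x y. (x, y) \<in> T \<Longrightarrow> (c *\<^sub>C x, c *\<^sub>C y) \<in> T"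
    "\<And>r x y. (x, y) \<in> T \<Longrightarrow> (r *\<^sub>R x, r *\<^sub>R y) \<in> T"
proof -
  show "(0, 0) \<in> T" using csubspace_0[OF assms] by (simp add: zero_prod_def)
  show "(x + x', y + y') \<in> T" "(x - x', y - y') \<in> T" if "(x, y) \<in> T" "(x', y') \<in> T" for x y x' y'
    using csubspace_add[OF assms that] csubspace_diff[OF assms that] by simp_all
  show "(c *\<^sub>C x, c *\<^sub>C y) \<in> T" "(r *\<^sub>R x, r *\<^sub>R y) \<in> T" if "(x, y) \<in> T" for c r x y
    using csubspace_scaleC[OF assms that, of c] csubspace_scaleR[OF assms that, of r]
    by (simp_all add: scaleC_prod_def)
qed

lemma symmetric_contraction_unique:
  assumes "symmetric_contraction T" "(x, y) \<in> T" "(x, y') \<in> T"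
  shows "y = y'"
  using symmetric_contractionD(3)[OF assms(1)
      csubspace_pair(3)[OF symmetric_contractionD(1)[OF assms(1)] assms(2,3)]] by simp

text \<open>A contraction maps Cauchy sequences to Cauchy sequences, so closedness of the graph passes to
  the domain.\<close>

lemma closed_Domain:
  fixes T :: "'a::chilbert_space graph"
  assumes T: "symmetric_contraction T"
  shows "closed_csubspace (Domain T)"
proof -
  note T' = symmetric_contractionD[OF T] csubspace_pair[OF symmetric_contractionD(1)[OF T]]
  have "csubspace (Domain T)"
    unfolding csubspace_def using T'(5,6,8) by (fastforce simp: Domain_iff)
  moreover have "closed (Domain T)"
    unfolding closed_sequential_limits
  proof (intro allI impI)
    fix f l assume "(\<forall>n. f n \<in> Domain T) \<and> f \<longlonglongrightarrow> l"
    then have "\<forall>n. \<exists>y. (f n, y) \<in> T" and f: "f \<longlonglongrightarrow> l" by blast+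
    then obtain g where g: "\<And>n. (f n, g n) \<in> T" by metis
    have "Cauchy g"
    proof (rule metric_CauchyI)
      fix e :: real assume "0 < e"
      then obtain M where M: "\<And>m n. m \<ge> M \<Longrightarrow> n \<ge> M \<Longrightarrow> dist (f m) (f n) < e"
        using LIMSEQ_imp_Cauchy[OF f] by (meson metric_CauchyD)
      have "dist (g m) (g n) \<le> dist (f m) (f n)" for m n
        using T'(3)[OF T'(7)[OF g g]] by (simp add: dist_norm)
      then show "\<exists>M. \<forall>m\<ge>M. \<forall>n\<ge>M. dist (g m) (g n) < e"
        using M by (meson le_less_trans)
    qed
    then obtain k where "g \<longlonglongrightarrow> k" using Cauchy_convergent_iff convergent_def by blast
    then have "(\<lambda>n. (f n, g n)) \<longlonglongrightarrow> (l, k)" by (intro tendsto_Pair f)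
    then have "(l, k) \<in> T" using closed_sequentially[OF T'(2), of "\<lambda>n. (f n, g n)"] g by simp
    then show "l \<in> Domain T" by blast
  qed
  ultimately show ?thesis by (simp add: closed_csubspace_def)
qed

text \<open>
  For a nonnegative form \<open>q\<close> this says that the shorted form \<open>x \<mapsto> inf {q (x - s) | s \<in> S}\<close>
  vanishes. For a symmetric contraction with domain \<open>S\<close> the smallest and the largest contractive
  self-adjoint extension \<open>A\<close> are those for which the form of \<open>I + A\<close>, respectively of
  \<open>I - A\<close>, has this property.
\<close>

definition null_modulo :: "('a::complex_inner \<Rightarrow> real) \<Rightarrow> 'a set \<Rightarrow> bool" where
  "null_modulo q S \<longleftrightarrow> (\<forall>x. \<forall>e>0. \<exists>s\<in>S. q (x - s) < e)"

lemma null_moduloD: "null_modulo q S \<Longrightarrow> 0 < e \<Longrightarrow> \<exists>s\<in>S. q (x - s) < e"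
  by (simp add: null_modulo_def)

text \<open>
  The operator \<open>I + A\<close> is built as a Gram operator \<open>W\<^sup>* W\<close>. On the domain \<open>S\<close> of
  \<open>T\<close> the map \<open>W\<close> has to be a square root \<open>V\<close> of the form of \<open>I + T\<close>, the values
  \<open>(I + T) s\<close> then determine the inner products of \<open>W y\<close> with \<open>V s\<close>, and minimality
  means that \<open>W y\<close> stays in the closure of \<open>V S\<close>.
\<close>

lemma minimal_extension:
  fixes T :: "'a::chilbert_space graph"
  assumes T: "symmetric_contraction T"
  obtains A where "bounded_selfadjoint A" "\<And>x y. (x, y) \<in> T \<Longrightarrow> A x = y"
    "\<And>x. 0 \<le> (norm x)\<^sup>2 + qform A x" "null_modulo (\<lambda>x. (norm x)\<^sup>2 + qform A x) (Domain T)"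
proof -
  note T' = symmetric_contractionD[OF T] csubspace_pair[OF symmetric_contractionD(1)[OF T]]
  obtain P where P: "bounded_selfadjoint P" "\<And>x. P x \<in> Domain T" "\<And>x. x \<in> Domain T \<Longrightarrow> P x = x"
    "\<And>x. norm (P x) \<le> norm x"
    by (rule orthogonal_projection_exists[OF closed_Domain[OF T]]) blast
  note clP = bounded_selfadjoint_clinear[OF P(1)]
  have "\<forall>x. \<exists>y. (P x, y) \<in> T" using P(2) by blast
  then obtain F where F: "\<And>x. (P x, F x) \<in> T" by metis
  have FT: "F x = y" if "(P x, y) \<in> T" for x y
    using symmetric_contraction_unique[OF T F that] .
  have Fnorm: "norm (F x) \<le> norm x" for x using T'(3)[OF F[of x]] P(4)[of x] by linarith
  have clF: "bounded_clinear F"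
  proof (rule bounded_clinearI[where K = 1])
    show "F (x + y) = F x + F y" for x y
      by (rule FT) (simp add: bounded_clinear_add[OF clP] T'(6) F)
    show "F (c *\<^sub>C x) = c *\<^sub>C F x" for c x
      by (rule FT) (simp add: bounded_clinear_scaleC[OF clP] T'(8) F)
  qed (use Fnorm in simp)
  have clPF: "bounded_clinear (\<lambda>x. P (F x))"
    using clP clF by (auto simp: bounded_clinear_def intro: bounded_linear_compose)
  have PF: "bounded_selfadjoint (\<lambda>x. P (F x))"
  proof (rule bounded_selfadjointI[OF clPF])
    show "cinner (P (F x)) y = cinner x (P (F y))" for x y
      using T'(4)[OF F F] by (simp add: bounded_selfadjoint_cinner[OF P(1), symmetric])
  qed
  define R where "R x = x + P (F x)" for x
  have R: "bounded_selfadjoint R" unfolding R_def[abs_def] by (intro bsa_intros PF)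
  have qR: "qform R x = (norm x)\<^sup>2 + Re (cinner (F x) (P x))" for x
    by (simp add: R_def qform_def cinner_simps norm_sq_cinner bounded_selfadjoint_cinner[OF P(1)])
  have R0: "0 \<le> qform R x" for x
  proof -
    have "- Re (cinner (F x) (P x)) \<le> norm (F x) * norm (P x)"
      using Re_cinner_le[of "- F x" "P x"] by (simp add: cinner_simps)
    also have "\<dots> \<le> norm x * norm x" by (intro mult_mono Fnorm P(4)) auto
    finally show ?thesis by (simp add: qR power2_eq_square)
  qed
  obtain V where V: "bounded_selfadjoint V" "\<And>x. V (V x) = R x"
    by (rule positive_sqrt_exists[OF R R0]) blast
  note clV = bounded_selfadjoint_clinear[OF V(1)]
  have on_dom: "P s = s" "F s = t" if "(s, t) \<in> T" for s t
  proof -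
    show "P s = s" using P(3) that by blast
    then show "F s = t" using FT[of s t] that by simp
  qed
  \<comment> \<open>\<open>\<parallel>s + T s\<parallel>\<^sup>2 \<le> 2 (s + T s, s)\<close> because \<open>T\<close> is a contraction\<close>
  have bound: "norm (fst p + snd p) \<le> sqrt 2 * norm (V (fst p))" if "p \<in> T" for p
  proof -
    obtain s t where p: "p = (s, t)" by (cases p)
    have st: "(s, t) \<in> T" using that p by simp
    have "(norm (s + t))\<^sup>2 \<le> 2 * ((norm s)\<^sup>2 + Re (cinner t s))"
      using power_mono[OF T'(3)[OF st], of 2] by (simp add: norm_sq_add Re_cinner_commute[of s t])
    also have "\<dots> = (sqrt 2 * norm (V s))\<^sup>2"
      by (simp add: power_mult_distrib norm_sqrt[of V R, OF V] qR on_dom[OF st])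
    finally show ?thesis unfolding p by (simp add: abs_le_square_iff[symmetric])
  qed
  have lin1: "clinear_on T (\<lambda>p. V (fst p))"
    by (simp add: clinear_on_def scaleC_prod_def bounded_clinear_add[OF clV] bounded_clinear_scaleC[OF clV])
  have lin2: "clinear_on T (\<lambda>p. fst p + snd p)"
    by (simp add: clinear_on_def scaleC_prod_def scaleC_add_right)
  have img: "(\<lambda>p. V (fst p)) ` T = V ` Domain T" by (force simp: Domain_fst image_image)
  obtain W where W: "bounded_clinear W"
    "\<And>p y. p \<in> T \<Longrightarrow> cinner (fst p + snd p) y = cinner (V (fst p)) (W y)"
    "\<And>y. W y \<in> closure (V ` Domain T)"
    by (rule douglas_factorization[OF T'(1) lin1 lin2 bound, unfolded img]) (assumption, simp, blast)
  have Wst: "cinner (s + t) y = cinner (V s) (W y)" if "(s, t) \<in> T" for s t y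
    using W(2)[OF that] by simp
  have subV: "csubspace (V ` Domain T)"
    using closed_Domain[OF T] unfolding closed_csubspace_def
    by (blast intro: csubspace_image bounded_clinear_clinear_on[OF clV])
  have WV: "W s = V s" if st: "(s, t) \<in> T" for s t
  proof (rule closure_eq_by_cinner[OF subV W(3)])
    show "V s \<in> closure (V ` Domain T)" using st closure_subset by fast
  next
    fix w assume "w \<in> V ` Domain T"
    then obtain s' t' where s': "(s', t') \<in> T" "w = V s'" by blast
    have "cinner w (V s) = cinner (R s') s"
      by (simp add: s'(2) V(2)[symmetric] bounded_selfadjoint_cinner[OF V(1), of "V s'"])
    also have "\<dots> = cinner s' s + cinner t' (P s)"
      by (simp add: R_def on_dom[OF s'(1)] cinner_simps bounded_selfadjoint_cinner[OF P(1)])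
    also have "\<dots> = cinner (s' + t') s" by (simp add: on_dom[OF st] cinner_simps)
    finally show "cinner w (W s) = cinner w (V s)" using Wst[OF s'(1), of s] s'(2) by simp
  qed
  obtain W' where W': "bounded_clinear W'" "\<And>x y. cinner (W x) y = cinner x (W' y)"
    by (rule adjoint_exists[OF W(1)]) blast
  define A where "A x = W' (W x) - x" for x
  have "bounded_selfadjoint (\<lambda>x. W' (W x))"
  proof (rule bounded_selfadjointI)
    show "bounded_clinear (\<lambda>x. W' (W x))"
      using W(1) W'(1) by (auto simp: bounded_clinear_def intro: bounded_linear_compose)
    show "cinner (W' (W x)) y = cinner x (W' (W y))" for x y
      by (subst cinner_commute) (simp add: W'(2)[symmetric] flip: cinner_commute)
  qed
  then have A: "bounded_selfadjoint A" unfolding A_def[abs_def] by (intro bsa_intros)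
  have AT: "A s = t" if st: "(s, t) \<in> T" for s t
  proof -
    have "W' (W s) = s + t"
    proof (rule cinner_eqI)
      fix y
      have "cinner (W y) (W s) = cnj (cinner (V s) (W y))"
        by (subst cinner_commute) (simp add: WV[OF st])
      then show "cinner y (W' (W s)) = cinner y (s + t)"
        by (simp add: W'(2)[symmetric] Wst[OF st, symmetric] flip: cinner_commute)
    qed
    then show ?thesis by (simp add: A_def)
  qed
  have qA: "(norm x)\<^sup>2 + qform A x = (norm (W x))\<^sup>2" for x
  proof -
    have "qform A x = Re (cinner (W' (W x)) x) - (norm x)\<^sup>2"
      by (simp add: A_def qform_def cinner_simps norm_sq_cinner)
    also have "Re (cinner (W' (W x)) x) = (norm (W x))\<^sup>2"
      by (subst Re_cinner_commute) (simp add: W'(2)[symmetric] norm_sq_cinner)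
    finally show ?thesis by simp
  qed
  have "null_modulo (\<lambda>x. (norm x)\<^sup>2 + qform A x) (Domain T)"
    unfolding null_modulo_def qA
  proof (intro allI impI)
    fix x and e :: real assume "0 < e"
    then obtain s where s: "s \<in> Domain T" "dist (V s) (W x) < sqrt e"
      using W(3)[of x] unfolding closure_approachable by (metis imageE real_sqrt_gt_zero)
    have "W (x - s) = W x - V s" using WV s(1) by (auto simp: bounded_clinear_diff[OF W(1)])
    then have "norm (W (x - s)) < sqrt e" using s(2) by (simp add: dist_norm norm_minus_commute)
    then have "(norm (W (x - s)))\<^sup>2 < e" using \<open>0 < e\<close> real_less_rsqrt
      by (metis norm_ge_zero real_sqrt_less_iff real_sqrt_unique)
    then show "\<exists>s\<in>Domain T. (norm (W (x - s)))\<^sup>2 < e" using s(1) by blast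
  qed
  then show thesis using that[OF A AT] qA by simp
qed

text \<open>
  Both operators agree on \<open>S\<close>, so the form of \<open>B - A\<close> does not change when an element of
  \<open>S\<close> is subtracted; choosing it well makes the form of \<open>I + A\<close> arbitrarily small.
\<close>

lemma minimal_le:
  assumes A: "bounded_selfadjoint A" and B: "bounded_selfadjoint B"
    and eq: "\<And>s. s \<in> S \<Longrightarrow> A s = B s"
    and pos: "\<And>x. 0 \<le> (norm x)\<^sup>2 + qform B x"
    and null: "null_modulo (\<lambda>x. (norm x)\<^sup>2 + qform A x) S"
  shows "op_le A B"
  unfolding op_le_qform
proof (rule allI, rule field_le_epsilon)
  fix x and e :: real assume "0 < e"
  then obtain s where s: "s \<in> S" "(norm (x - s))\<^sup>2 + qform A (x - s) < e"
    using null_moduloD[OF null \<open>0 < e\<close>, of x] by blast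
  have "qform (\<lambda>x. B x - A x) (x - s) = qform (\<lambda>x. B x - A x) x"
    by (rule qform_kernel[OF bsa_diff[OF B A]]) (simp add: eq[OF s(1)])
  then have "qform B (x - s) - qform A (x - s) = qform B x - qform A x"
    by (simp add: qform_def cinner_simps)
  then show "qform A x \<le> qform B x + e" using s(2) pos[of "x - s"] by linarith
qed

text \<open>
  The heart of the matter is that the smallest extension with \<open>I + A \<ge> 0\<close> lies below the largest
  one with \<open>I - B \<ge> 0\<close>: for \<open>u = x - s\<close> and \<open>v = x - s'\<close> the difference
  \<open>u - v\<close> lies in the domain of \<open>T\<close>, where \<open>T\<close> is a contraction.
\<close>

lemma minimal_le_maximal:
  assumes A: "bounded_selfadjoint A" and B: "bounded_selfadjoint B" and S: "csubspace S"
    and eq: "\<And>s. s \<in> S \<Longrightarrow> A s = B s" and contr: "\<And>s. s \<in> S \<Longrightarrow> norm (A s) \<le> norm s"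
    and nullA: "null_modulo (\<lambda>x. (norm x)\<^sup>2 + qform A x) S"
    and nullB: "null_modulo (\<lambda>x. (norm x)\<^sup>2 - qform B x) S"
  shows "op_le A B"
  unfolding op_le_qform
proof (rule allI, rule field_le_epsilon)
  fix x and e :: real assume "0 < e"
  then obtain s where s: "s \<in> S" "(norm (x - s))\<^sup>2 + qform A (x - s) < e/2"
    using null_moduloD[OF nullA, of "e/2" x] \<open>0 < e\<close> by auto
  obtain s' where s': "s' \<in> S" "(norm (x - s'))\<^sup>2 - qform B (x - s') < e/2"
    using null_moduloD[OF nullB, of "e/2" x] \<open>0 < e\<close> by auto
  define u v where "u = x - s" and "v = x - s'"
  define m p where "m = u - v" and "p = u + v"
  have m: "m \<in> S" unfolding m_def u_def v_def using csubspace_diff[OF S s'(1) s(1)] by simp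
  have "qform (\<lambda>x. B x - A x) v = qform (\<lambda>x. B x - A x) x"
    unfolding v_def by (rule qform_kernel[OF bsa_diff[OF B A]]) (simp add: eq[OF s'(1)])
  then have D: "qform B v - qform A v = qform B x - qform A x"
    by (simp add: qform_def cinner_simps)
  have "norm m * norm p \<le> ((norm m)\<^sup>2 + (norm p)\<^sup>2) / 2"
    using sum_squares_bound[of "norm m" "norm p"] by (simp add: mult.assoc)
  also have "\<dots> = (norm u)\<^sup>2 + (norm v)\<^sup>2"
    by (simp add: m_def p_def norm_sq_add norm_sq_diff)
  finally have mp: "norm m * norm p \<le> (norm u)\<^sup>2 + (norm v)\<^sup>2" .
  have "- Re (cinner (A m) p) \<le> norm (A m) * norm p"
    using Re_cinner_le[of "- A m" p] by (simp add: cinner_simps)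
  also have "\<dots> \<le> norm m * norm p" by (rule mult_right_mono[OF contr[OF m]]) simp
  also have "Re (cinner (A m) p) = qform A u - qform A v"
    using Re_cinner_swap[OF A, of u v] unfolding m_def p_def
    by (simp add: qform_def bounded_clinear_diff[OF bounded_selfadjoint_clinear[OF A]] cinner_simps)
  finally have "0 \<le> (norm u)\<^sup>2 + qform A u + ((norm v)\<^sup>2 - qform A v)" using mp by linarith
  then show "qform A x \<le> qform B x + e"
    using s(2) s'(2) D unfolding u_def v_def by linarith
qed

lemma closed_csubspace_vimage:
  assumes f: "bounded_clinear f" and S: "closed_csubspace S"
  shows "closed_csubspace (f -` S)"
proof -
  have "csubspace (f -` S)"
    using S unfolding closed_csubspace_def csubspace_def
    by (simp add: bounded_clinear_zero[OF f] bounded_clinear_add[OF f] bounded_clinear_scaleC[OF f])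
  moreover have "closed (f -` S)"
    using S linear_continuous_at[OF bounded_clinear_bounded[OF f]]
    by (auto simp: closed_csubspace_def intro: continuous_closed_vimage)
  ultimately show ?thesis by (simp add: closed_csubspace_def)
qed

lemma symmetric_contraction_uminus:
  fixes T :: "'a::complex_inner graph"
  assumes "symmetric_contraction T"
  shows "symmetric_contraction {(x, - y) |x y. (x, y) \<in> T}"
proof -
  note T' = symmetric_contractionD[OF assms] csubspace_pair[OF symmetric_contractionD(1)[OF assms]]
  have eq: "{(x, - y) |x y. (x, y) \<in> T} = (\<lambda>p. (fst p, - snd p)) -` T"
    by auto (metis add.inverse_inverse)
  have "bounded_clinear (\<lambda>p::'a \<times> 'a. (fst p, - snd p))"
    by (auto simp: bounded_clinear_def scaleC_prod_def scaleC_minus_right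
        intro!: bounded_linear_Pair bounded_linear_fst bounded_linear_minus bounded_linear_snd)
  then have "closed_csubspace {(x, - y) |x y. (x, y) \<in> T}"
    unfolding eq by (rule closed_csubspace_vimage) (use T'(1,2) in \<open>simp add: closed_csubspace_def\<close>)
  then show ?thesis
    unfolding symmetric_contraction_def
    using T'(3,4) by (auto simp: cinner_simps)
qed

lemma maximal_extension:
  fixes T :: "'a::chilbert_space graph"
  assumes T: "symmetric_contraction T"
  obtains B where "bounded_selfadjoint B" "\<And>x y. (x, y) \<in> T \<Longrightarrow> B x = y"
    "\<And>x. 0 \<le> (norm x)\<^sup>2 - qform B x" "null_modulo (\<lambda>x. (norm x)\<^sup>2 - qform B x) (Domain T)"
proof -
  let ?T = "{(x, - y) |x y. (x, y) \<in> T}"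
  obtain A where A: "bounded_selfadjoint A" "\<And>x y. (x, y) \<in> ?T \<Longrightarrow> A x = y"
    "\<And>x. 0 \<le> (norm x)\<^sup>2 + qform A x" "null_modulo (\<lambda>x. (norm x)\<^sup>2 + qform A x) (Domain ?T)"
    by (rule minimal_extension[OF symmetric_contraction_uminus[OF T]]) blast
  have D: "Domain ?T = Domain T" by (auto simp: Domain_iff)
  have q: "qform (\<lambda>x. - A x) x = - qform A x" for x by (simp add: qform_def cinner_simps)
  show thesis
  proof (rule that[of "\<lambda>x. - A x"])
    show "- A x = y" if "(x, y) \<in> T" for x y using A(2)[of x "- y"] that by auto
  qed (use A in \<open>simp_all add: bsa_minus D q\<close>)
qed

lemma op_le_trans: "op_le A B \<Longrightarrow> op_le B C \<Longrightarrow> op_le A C"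
  unfolding op_le_def by (meson order_trans)

lemma op_interval_ends_unique:
  fixes A B :: "'a::complex_inner \<Rightarrow> 'a"
  assumes bsa: "bounded_selfadjoint A" "bounded_selfadjoint B" "bounded_selfadjoint A'" "bounded_selfadjoint B'"
    and "op_le A B" and eq: "op_interval A B = op_interval A' B'"
  shows "A' = A" "B' = B"
proof -
  have refl: "op_le X X" for X :: "'a \<Rightarrow> 'a" by (simp add: op_le_def)
  have "A \<in> op_interval A B" "B \<in> op_interval A B"
    using assms(1,2,5) refl by (auto simp: op_interval_def)
  then have "A \<in> op_interval A' B'" "B \<in> op_interval A' B'" by (simp_all only: eq)
  then have 1: "op_le A' A" "op_le B B'" "op_le A' B'"
    unfolding op_interval_def using op_le_trans by blast+
  have "A' \<in> op_interval A' B'" "B' \<in> op_interval A' B'"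
    using bsa(3,4) 1(3) refl by (auto simp: op_interval_def)
  then have "A' \<in> op_interval A B" "B' \<in> op_interval A B" by (simp_all only: eq)
  then have 2: "op_le A A'" "op_le B' B" unfolding op_interval_def by auto
  show "A' = A" by (rule op_le_antisym[OF bsa(3,1) 1(1) 2(1)])
  show "B' = B" by (rule op_le_antisym[OF bsa(4,2) 2(2) 1(2)])
qed

text \<open>
  The inequality \<open>A \<le> B\<close> makes the interval nonempty; only then does it determine its ends.
\<close>

definition extremal_pair :: "'a::complex_inner graph \<Rightarrow> ('a \<Rightarrow> 'a) \<Rightarrow> ('a \<Rightarrow> 'a) \<Rightarrow> bool" where
  "extremal_pair T A B \<longleftrightarrow> bounded_selfadjoint A \<and> bounded_selfadjoint B \<and>
     (\<forall>(x, y)\<in>T. A x = y \<and> B x = y) \<and> op_le A B \<and>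
     sa_contractive_extensions T = op_interval A B \<and>
     null_modulo (\<lambda>x. (norm x)\<^sup>2 + qform A x) (Domain T) \<and>
     null_modulo (\<lambda>x. (norm x)\<^sup>2 - qform B x) (Domain T)"

text \<open>
  Krein's theorem. An operator in the interval extends \<open>T\<close> because there the two ends coincide
  as forms, and a nonnegative form vanishes only on the kernel.
\<close>

lemma extremal_pair_exists:
  fixes T :: "'a::chilbert_space graph"
  assumes T: "symmetric_contraction T"
  obtains A B where "extremal_pair T A B"
proof -
  obtain A where A: "bounded_selfadjoint A" "\<And>x y. (x, y) \<in> T \<Longrightarrow> A x = y"
    "\<And>x. 0 \<le> (norm x)\<^sup>2 + qform A x" "null_modulo (\<lambda>x. (norm x)\<^sup>2 + qform A x) (Domain T)"
    by (rule minimal_extension[OF T]) blast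
  obtain B where B: "bounded_selfadjoint B" "\<And>x y. (x, y) \<in> T \<Longrightarrow> B x = y"
    "\<And>x. 0 \<le> (norm x)\<^sup>2 - qform B x" "null_modulo (\<lambda>x. (norm x)\<^sup>2 - qform B x) (Domain T)"
    by (rule maximal_extension[OF T]) blast
  have S: "csubspace (Domain T)" using closed_Domain[OF T] by (simp add: closed_csubspace_def)
  have AB: "op_le A B"
  proof (rule minimal_le_maximal[OF A(1) B(1) S _ _ A(4) B(4)])
    show "A s = B s" "norm (A s) \<le> norm s" if "s \<in> Domain T" for s
      using that A(2) B(2) symmetric_contractionD(3)[OF T] by (auto simp: Domain_iff)
  qed
  have below: "op_le A X" and above: "op_le X B" if "X \<in> sa_contractive_extensions T" for X
  proof -
    have X: "bounded_selfadjoint X" "\<And>x. norm (X x) \<le> norm x" "\<And>x y. (x, y) \<in> T \<Longrightarrow> X x = y"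
      using that unfolding sa_contractive_extensions_def by auto
    have qX: "0 \<le> (norm x)\<^sup>2 + qform X x" "0 \<le> (norm x)\<^sup>2 - qform X x" for x
      using form_bounds_of_contraction[of X x, OF X(2)] by linarith+
    show "op_le A X"
      by (rule minimal_le[OF A(1) X(1) _ qX(1) A(4)]) (use A(2) X(3) in fastforce)
    have neg: "qform (\<lambda>x. - Y x) x = - qform Y x" for Y and x :: 'a by (simp add: qform_def cinner_simps)
    have "op_le (\<lambda>x. - B x) (\<lambda>x. - X x)"
      by (rule minimal_le[OF bsa_minus[OF B(1)] bsa_minus[OF X(1)], where S = "Domain T"])
        (use B(2,4) X(3) qX(2) in \<open>auto simp: neg\<close>)
    then show "op_le X B" by (simp add: op_le_qform neg)
  qed
  have "X \<in> sa_contractive_extensions T" if "X \<in> op_interval A B" for X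
  proof -
    have X: "bounded_selfadjoint X" "\<And>x. qform A x \<le> qform X x" "\<And>x. qform X x \<le> qform B x"
      using that unfolding op_interval_def op_le_qform by auto
    have "norm (X x) \<le> norm x" for x
    proof (rule contraction_of_form_bounds[OF X(1)])
      show "\<bar>qform X x\<bar> \<le> (norm x)\<^sup>2" for x
        using X(2,3)[of x] A(3)[of x] B(3)[of x] by linarith
    qed
    moreover have "X x = y" if xy: "(x, y) \<in> T" for x y
    proof -
      have q: "qform (\<lambda>x. X x - A x) z = qform X z - qform A z" for z
        by (simp add: qform_def cinner_simps)
      have "qform B x = qform A x" using A(2)[OF xy] B(2)[OF xy] by (simp add: qform_def)
      have "X x - A x = 0"
      proof (rule qform_zero_imp_kernel[OF bsa_diff[OF X(1) A(1)]])
        show "0 \<le> qform (\<lambda>x. X x - A x) z" for z unfolding q using X(2)[of z] by simp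
        show "qform (\<lambda>x. X x - A x) x = 0" unfolding q
          using X(2,3)[of x] \<open>qform B x = qform A x\<close> by simp
      qed
      then show ?thesis using A(2)[OF xy] by simp
    qed
    ultimately show ?thesis using X(1) by (auto simp: sa_contractive_extensions_def)
  qed
  moreover have "X \<in> op_interval A B" if "X \<in> sa_contractive_extensions T" for X
    using below[OF that] above[OF that] that
    by (simp add: op_interval_def sa_contractive_extensions_def)
  ultimately have "sa_contractive_extensions T = op_interval A B" by blast
  moreover have "\<forall>(x, y)\<in>T. A x = y \<and> B x = y" using A(2) B(2) by blast
  ultimately have "extremal_pair T A B"
    unfolding extremal_pair_def by (intro conjI A(1,4) B(1,4) AB)
  then show thesis by (rule that)
qed

lemma extremal_pair_T_mu_T_M:
  fixes J :: "'a::chilbert_space \<Rightarrow> 'a"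
  assumes "symmetric_contraction (T_zero J Lp Lm)"
  shows "extremal_pair (T_zero J Lp Lm) (T_mu J Lp Lm) (T_M J Lp Lm)"
proof -
  let ?T = "T_zero J Lp Lm"
  obtain A B where AB: "extremal_pair ?T A B" by (rule extremal_pair_exists[OF assms])
  then have AB': "bounded_selfadjoint A" "bounded_selfadjoint B" "op_le A B"
    "sa_contractive_extensions ?T = op_interval A B"
    by (auto simp: extremal_pair_def)
  have "T_mu J Lp Lm = A"
    unfolding T_mu_def
  proof (rule the_equality)
    fix A' assume "\<exists>B. bounded_selfadjoint A' \<and> bounded_selfadjoint B \<and>
      sa_contractive_extensions ?T = op_interval A' B"
    then obtain B' where "bounded_selfadjoint A'" "bounded_selfadjoint B'"
      "op_interval A B = op_interval A' B'" using AB'(4) by auto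
    then show "A' = A" by (rule op_interval_ends_unique(1)[OF AB'(1,2) _ _ AB'(3)])
  qed (use AB' in blast)
  moreover have "T_M J Lp Lm = B"
    unfolding T_M_def
  proof (rule the_equality)
    fix B' assume "\<exists>A. bounded_selfadjoint A \<and> bounded_selfadjoint B' \<and>
      sa_contractive_extensions ?T = op_interval A B'"
    then obtain A' where "bounded_selfadjoint A'" "bounded_selfadjoint B'"
      "op_interval A B = op_interval A' B'" using AB'(4) by auto
    then show "B' = B" by (rule op_interval_ends_unique(2)[OF AB'(1,2) _ _ AB'(3)])
  qed (use AB' in blast)
  ultimately show ?thesis using AB by simp
qed

section \<open>Density in the energy space\<close>

text \<open>
  Only an isometric map into a complete space matters: it identifies the classes of Cauchy sequences
  with limits of their images, and \<open>energy_dist\<close> with the distance of these limits.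
\<close>

lemma energy_dist_limit:
  fixes G :: "'a::complex_inner graph" and D :: "'a \<Rightarrow> 'b::real_normed_vector"
  assumes iso: "\<And>f g. f \<in> Domain G \<Longrightarrow> g \<in> Domain G \<Longrightarrow> energy_norm G (f - g) = norm (D f - D g)"
    and F: "F \<in> energy_Cauchy G" "(\<lambda>n. D (F n)) \<longlonglongrightarrow> a" and f: "f \<in> Domain G"
  shows "energy_dist G (energy_rel G `` {F}) (energy_embed G f) = norm (a - D f)"
proof -
  have zero: "energy_norm G 0 = 0" using iso[OF f f] by simp
  have const: "(\<lambda>n. h) \<in> energy_Cauchy G" if "h \<in> Domain G" for h
    using that iso[of h h] by (simp add: energy_Cauchy_def)
  have rep: "(\<lambda>n. D ((SOME K. K \<in> energy_rel G `` {H}) n)) \<longlonglongrightarrow> b \<and>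
      (\<forall>n. (SOME K. K \<in> energy_rel G `` {H}) n \<in> Domain G)"
    if H: "H \<in> energy_Cauchy G" "(\<lambda>n. D (H n)) \<longlonglongrightarrow> b" for H b
  proof -
    define K where "K = (SOME K. K \<in> energy_rel G `` {H})"
    have dom: "H n \<in> Domain G" for n using H(1) by (simp add: energy_Cauchy_def)
    have "H \<in> energy_rel G `` {H}"
      using H(1) by (simp add: energy_rel_def zero)
    then have "K \<in> energy_rel G `` {H}" unfolding K_def by (rule someI[where P = "\<lambda>K. K \<in> energy_rel G `` {H}"])
    then have K: "K \<in> energy_Cauchy G" "(\<lambda>n. energy_norm G (H n - K n)) \<longlonglongrightarrow> 0"
      by (simp_all add: energy_rel_def)
    have domK: "K n \<in> Domain G" for n using K(1) by (simp add: energy_Cauchy_def)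
    have "(\<lambda>n. D (H n) - D (K n)) \<longlonglongrightarrow> 0"
      using K(2) by (simp add: iso[OF dom domK] tendsto_norm_zero_iff)
    from tendsto_diff[OF H(2) this] have "(\<lambda>n. D (K n)) \<longlonglongrightarrow> b" by simp
    then show ?thesis using domK unfolding K_def by blast
  qed
  define K where "K = (SOME K. K \<in> energy_rel G `` {F})"
  define H where "H = (SOME H. H \<in> energy_rel G `` {\<lambda>n. f})"
  have K: "(\<lambda>n. D (K n)) \<longlonglongrightarrow> a" "\<And>n. K n \<in> Domain G"
    using rep[OF F] unfolding K_def by blast+
  have H: "(\<lambda>n. D (H n)) \<longlonglongrightarrow> D f" "\<And>n. H n \<in> Domain G"
    using rep[OF const[OF f] tendsto_const] unfolding H_def by blast+
  have "(\<lambda>n. energy_norm G (K n - H n)) \<longlonglongrightarrow> norm (a - D f)"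
    unfolding iso[OF K(2) H(2)] by (intro tendsto_norm tendsto_diff K(1) H(1))
  then show ?thesis
    unfolding energy_dist_def energy_embed_def K_def[symmetric] H_def[symmetric] by (rule limI)
qed

lemma dense_in_energy_completion_iff:
  fixes G :: "'a::complex_inner graph" and D :: "'a \<Rightarrow> 'b::chilbert_space"
  assumes iso: "\<And>f g. f \<in> Domain G \<Longrightarrow> g \<in> Domain G \<Longrightarrow> energy_norm G (f - g) = norm (D f - D g)"
    and S: "S \<subseteq> Domain G"
  shows "dense_in_energy_completion S G \<longleftrightarrow>
    (\<forall>f\<in>Domain G. \<forall>e>0. \<exists>s\<in>S. energy_norm G (f - s) < e)"
proof
  assume dense: "dense_in_energy_completion S G"
  show "\<forall>f\<in>Domain G. \<forall>e>0. \<exists>s\<in>S. energy_norm G (f - s) < e"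
  proof (intro ballI allI impI)
    fix f and e :: real assume f: "f \<in> Domain G" and "0 < e"
    have F: "(\<lambda>n. f) \<in> energy_Cauchy G" using f iso[OF f f] by (simp add: energy_Cauchy_def)
    then have "energy_embed G f \<in> energy_completion G"
      unfolding energy_completion_def energy_embed_def by (rule quotientI)
    then obtain s where s: "s \<in> S" "energy_dist G (energy_embed G f) (energy_embed G s) < e"
      using dense \<open>0 < e\<close> unfolding dense_in_energy_completion_def by blast
    have "energy_dist G (energy_embed G f) (energy_embed G s) = norm (D f - D s)"
      unfolding energy_embed_def[of G f] using s(1) S
      by (intro energy_dist_limit[where G = G and D = D, OF iso F tendsto_const]) blast+
    then show "\<exists>s\<in>S. energy_norm G (f - s) < e"
      using s iso[OF f subsetD[OF S s(1)]] by (intro bexI[of _ s]) auto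
  qed
next
  assume approx: "\<forall>f\<in>Domain G. \<forall>e>0. \<exists>s\<in>S. energy_norm G (f - s) < e"
  have "\<exists>s\<in>S. energy_dist G X (energy_embed G s) < e"
    if XG: "X \<in> energy_completion G" and "0 < e" for X and e :: real
  proof -
    obtain F where F: "F \<in> energy_Cauchy G" and X: "X = energy_rel G `` {F}"
      using XG unfolding energy_completion_def by (rule quotientE)
    have dom: "F n \<in> Domain G" for n using F by (simp add: energy_Cauchy_def)
    have "Cauchy (\<lambda>n. D (F n))"
    proof (rule metric_CauchyI)
      fix r :: real assume "0 < r"
      then show "\<exists>M. \<forall>m\<ge>M. \<forall>n\<ge>M. dist (D (F m)) (D (F n)) < r"
        using F unfolding energy_Cauchy_def by (simp add: iso[OF dom dom] dist_norm)
    qed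
    then obtain a where a: "(\<lambda>n. D (F n)) \<longlonglongrightarrow> a"
      using Cauchy_convergent_iff convergent_def by blast
    obtain n where n: "norm (D (F n) - a) < e / 2"
      using LIMSEQ_D[OF a, of "e / 2"] \<open>0 < e\<close> by auto
    obtain s where s: "s \<in> S" "energy_norm G (F n - s) < e / 2"
      using approx dom[of n] half_gt_zero[OF \<open>0 < e\<close>] by blast
    then have sG: "s \<in> Domain G" using S by blast
    have "energy_dist G X (energy_embed G s) = norm (a - D s)"
      unfolding X by (rule energy_dist_limit[where G = G and D = D, OF iso F a sG])
    also have "\<dots> \<le> norm (D (F n) - a) + norm (D (F n) - D s)"
      using norm_triangle_ineq[of "a - D (F n)" "D (F n) - D s"]
      by (simp add: norm_minus_commute)
    also have "\<dots> < e" using n s(2) iso[OF dom sG, of n] by simp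
    finally show ?thesis using s(1) by blast
  qed
  then show "dense_in_energy_completion S G"
    using S unfolding dense_in_energy_completion_def by blast
qed

section \<open>The Cayley transform\<close>

definition cayley_graph :: "('a::complex_inner \<Rightarrow> 'a) \<Rightarrow> 'a graph" where
  "cayley_graph T = {(x + T x, x - T x) |x. True}"

lemma cayley_graphI: "(x + T x, x - T x) \<in> cayley_graph T"
  by (auto simp: cayley_graph_def)

lemma cayley_graphE:
  assumes "(f, g) \<in> cayley_graph T"
  obtains x where "f = x + T x" "g = x - T x"
  using assms by (auto simp: cayley_graph_def)

lemma Domain_cayley_graph: "Domain (cayley_graph T) = range (\<lambda>x. x + T x)"
  by (auto simp: cayley_graph_def Domain_iff)

lemma half_sum: "(1/2) *\<^sub>R (x + x) = (x::'a::real_vector)"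
  by (simp flip: scaleR_2)

text \<open>
  For \<open>(g, h)\<close> in the adjoint of the Cayley transform the vector \<open>x = (g + h)/2\<close> is the
  parameter of \<open>(g, h)\<close> itself.
\<close>

lemma adjoint_cayley_graph:
  assumes T: "bounded_selfadjoint (T :: 'a::complex_inner \<Rightarrow> 'a)"
  shows "adjoint_op (cayley_graph T) = cayley_graph T"
proof -
  note clT = bounded_selfadjoint_clinear[OF T]
  have key: "cinner (x - T x) g = cinner (x + T x) h \<longleftrightarrow> cinner x (g - T g) = cinner x (h + T h)" for x g h
    by (simp add: cinner_simps bounded_selfadjoint_cinner[OF T])
  have "(g, h) \<in> adjoint_op (cayley_graph T) \<longleftrightarrow> g - T g = h + T h" for g h
  proof
    assume "(g, h) \<in> adjoint_op (cayley_graph T)"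
    then have "cinner (x - T x) g = cinner (x + T x) h" for x
      using cayley_graphI[of x T] unfolding adjoint_op_def by auto
    then show "g - T g = h + T h" using key by (blast intro: cinner_eqI)
  next
    assume "g - T g = h + T h"
    then have "cinner (x - T x) g = cinner (x + T x) h" for x using key[of x g h] by simp
    then show "(g, h) \<in> adjoint_op (cayley_graph T)"
      unfolding adjoint_op_def cayley_graph_def by auto
  qed
  moreover have "(g, h) \<in> cayley_graph T \<longleftrightarrow> g - T g = h + T h" for g h
  proof
    assume "(g, h) \<in> cayley_graph T"
    then show "g - T g = h + T h"
      by (auto elim!: cayley_graphE simp: bounded_clinear_add[OF clT] bounded_clinear_diff[OF clT])
  next
    assume eq: "g - T g = h + T h"
    define x where "x = (1/2) *\<^sub>R (g + h)"
    have "T g + T h = g - h" using eq by (simp add: algebra_simps)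
    then have Tx: "T x = (1/2) *\<^sub>R (g - h)"
      by (simp add: x_def bounded_clinear_scaleR[OF clT] bounded_clinear_add[OF clT])
    have "x + T x = (1/2) *\<^sub>R (g + g)" "x - T x = (1/2) *\<^sub>R (h + h)"
      unfolding Tx unfolding x_def scaleR_add_right[symmetric] scaleR_diff_right[symmetric] by simp_all
    then show "(g, h) \<in> cayley_graph T" using cayley_graphI[of x T] by (simp only: half_sum)
  qed
  ultimately show ?thesis by (auto simp: set_eq_iff)
qed

lemma csubspace_cayley_graph:
  assumes "bounded_clinear T"
  shows "csubspace (cayley_graph T)"
proof -
  have "cayley_graph T = range (\<lambda>x. (x + T x, x - T x))" by (auto simp: cayley_graph_def)
  moreover have "clinear_on UNIV (\<lambda>x. (x + T x, x - T x))"
    by (simp add: clinear_on_def scaleC_prod_def bounded_clinear_add[OF assms]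
        bounded_clinear_scaleC[OF assms] scaleC_add_right scaleC_diff_right)
  ultimately show ?thesis using csubspace_image[OF csubspace_UNIV] by metis
qed

lemma cayley_form: "Re (cinner (x - y) (x + y)) = (norm x)\<^sup>2 - (norm (y::'a::complex_inner))\<^sup>2"
  by (simp add: norm_sq_cinner cinner_simps Re_cinner_commute[of y x])

text \<open>
  Self-adjointness enters twice: it makes the range of \<open>I + G\<close> closed and, with nonnegativity,
  leaves nothing orthogonal to it.
\<close>

lemma range_one_plus_nonneg:
  fixes G :: "'a::chilbert_space graph"
  assumes sub: "csubspace G" and adj: "adjoint_op G = G"
    and nonneg: "\<And>f g. (f, g) \<in> G \<Longrightarrow> 0 \<le> Re (cinner g f)"
  shows "\<exists>f g. (f, g) \<in> G \<and> y = f + g"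
proof -
  define Y where "Y = (\<lambda>(f, g). f + g) ` G"
  have sum: "(norm f)\<^sup>2 + (norm g)\<^sup>2 \<le> (norm (f + g))\<^sup>2" if "(f, g) \<in> G" for f g
    using nonneg[OF that] by (simp add: norm_sq_add Re_cinner_commute[of f g])
  have "clinear_on G (\<lambda>(f, g). f + g)"
    by (auto simp: clinear_on_def scaleC_prod_def scaleC_add_right)
  then have subY: "csubspace Y" unfolding Y_def by (rule csubspace_image[OF sub])
  have "closed Y"
    unfolding closed_sequential_limits
  proof (intro allI impI)
    fix h l assume "(\<forall>n. h n \<in> Y) \<and> h \<longlonglongrightarrow> l"
    then have "\<forall>n. \<exists>p. p \<in> G \<and> h n = fst p + snd p" and h: "h \<longlonglongrightarrow> l"
      unfolding Y_def by force+
    then obtain p where p: "\<And>n. p n \<in> G" "\<And>n. h n = fst (p n) + snd (p n)" by metis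
    have pd: "norm (p m - p n) \<le> norm (h m - h n)" for m n
    proof -
      obtain a b where ab: "p m - p n = (a, b)" by (cases "p m - p n")
      have "(a, b) \<in> G" using csubspace_diff[OF sub p(1) p(1)] ab by metis
      moreover have "h m - h n = a + b"
        using arg_cong[OF ab, of fst] arg_cong[OF ab, of snd] by (simp add: p(2) algebra_simps)
      ultimately show ?thesis using sum[of a b] unfolding ab norm_Pair
        by (simp add: real_le_lsqrt)
    qed
    have "Cauchy p"
    proof (rule metric_CauchyI)
      fix e :: real assume "0 < e"
      then obtain N where N: "\<And>m n. m \<ge> N \<Longrightarrow> n \<ge> N \<Longrightarrow> dist (h m) (h n) < e"
        using LIMSEQ_imp_Cauchy[OF h] by (meson metric_CauchyD)
      have "dist (p m) (p n) < e" if "m \<ge> N" "n \<ge> N" for m n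
        using pd[of m n] N[OF that] by (simp add: dist_norm)
      then show "\<exists>N. \<forall>m\<ge>N. \<forall>n\<ge>N. dist (p m) (p n) < e" by blast
    qed
    then obtain q where q: "p \<longlonglongrightarrow> q" using Cauchy_convergent_iff convergent_def by blast
    have "q \<in> adjoint_op G"
    proof -
      obtain a b where ab: "q = (a, b)" by (cases q)
      have lim: "(\<lambda>n. fst (p n)) \<longlonglongrightarrow> a" "(\<lambda>n. snd (p n)) \<longlonglongrightarrow> b"
        using tendsto_fst[OF q] tendsto_snd[OF q] by (simp_all add: ab)
      have "cinner k a = cinner f b" if fk: "(f, k) \<in> G" for f k
      proof -
        have "cinner k (fst (p n)) = cinner f (snd (p n))" for n
        proof -
          have "(fst (p n), snd (p n)) \<in> adjoint_op G" using p(1)[of n] adj by simp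
          then show ?thesis using fk unfolding adjoint_op_def by blast
        qed
        then show ?thesis
          using LIMSEQ_unique[OF tendsto_cinner[OF tendsto_const lim(1), of k]]
            tendsto_cinner[OF tendsto_const lim(2), of f] by simp
      qed
      then show ?thesis by (auto simp: adjoint_op_def ab)
    qed
    then have "q \<in> G" using adj by simp
    have "h \<longlonglongrightarrow> fst q + snd q"
      unfolding p(2) by (intro tendsto_add tendsto_fst tendsto_snd q)
    then have "l = fst q + snd q" using LIMSEQ_unique[OF h] by simp
    then show "l \<in> Y" using \<open>q \<in> G\<close> unfolding Y_def by force
  qed
  then have Y: "closed_csubspace Y" using subY by (simp add: closed_csubspace_def)
  obtain P where P: "bounded_selfadjoint P" "\<And>x. P x \<in> Y" "\<And>x. x \<in> Y \<Longrightarrow> P x = x"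
    by (rule orthogonal_projection_exists[OF Y]) blast
  define z where "z = y - P y"
  have orth: "cinner (f + k) z = 0" if "(f, k) \<in> G" for f k
  proof -
    have "f + k \<in> Y" unfolding Y_def using that by force
    then have "cinner (f + k) (P y) = cinner (f + k) y"
      by (simp add: bounded_selfadjoint_cinner[OF P(1), symmetric] P(3))
    then show ?thesis by (simp add: z_def cinner_diff_right)
  qed
  have "(z, - z) \<in> adjoint_op G"
    unfolding adjoint_op_def
  proof (clarsimp)
    fix f k assume "(f, k) \<in> G"
    from orth[OF this] show "cinner k z = cinner f (- z)"
      by (simp add: cinner_simps add_eq_0_iff)
  qed
  then have "(z, - z) \<in> G" using adj by simp
  from nonneg[OF this] have "z = 0" by (simp add: cinner_simps flip: norm_sq_cinner)
  then have "y \<in> Y" using P(2)[of y] by (simp add: z_def)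
  then show ?thesis unfolding Y_def by auto
qed

text \<open>
  The map \<open>T : f + G f \<mapsto> f - G f\<close> is everywhere defined since \<open>I + G\<close> is onto, and
  nonnegativity of \<open>G\<close> is exactly its contractivity.
\<close>

lemma cayley_of_nonneg:
  fixes G :: "'a::chilbert_space graph"
  assumes sub: "csubspace G" and adj: "adjoint_op G = G"
    and nonneg: "\<And>f g. (f, g) \<in> G \<Longrightarrow> 0 \<le> Re (cinner g f)"
  obtains T where "bounded_selfadjoint T" "\<And>x. norm (T x) \<le> norm x" "G = cayley_graph T"
proof -
  note G' = csubspace_pair[OF sub]
  have contr: "norm (f - g) \<le> norm (f + g)" if "(f, g) \<in> G" for f g
  proof -
    have "(norm (f - g))\<^sup>2 \<le> (norm (f + g))\<^sup>2"
      using nonneg[OF that] by (simp add: norm_sq_add norm_sq_diff Re_cinner_commute[of f g])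
    then show ?thesis by (simp add: abs_le_square_iff[symmetric])
  qed
  have uniq: "f - g = f' - g'" if "(f, g) \<in> G" "(f', g') \<in> G" "f + g = f' + g'" for f g f' g'
  proof -
    have "f - f' + (g - g') = 0" using that(3) by (simp add: algebra_simps)
    then have "f - f' - (g - g') = 0" using contr[OF G'(3)[OF that(1,2)]] by simp
    then show ?thesis by (simp add: algebra_simps)
  qed
  have "\<forall>y. \<exists>p. p \<in> G \<and> y = fst p + snd p"
    using range_one_plus_nonneg[OF assms] by (metis fst_conv snd_conv)
  then obtain p where p: "\<And>y. p y \<in> G" "\<And>y. y = fst (p y) + snd (p y)" by metis
  define T where "T y = fst (p y) - snd (p y)" for y
  have T: "T (f + g) = f - g" if "(f, g) \<in> G" for f g
    unfolding T_def by (rule uniq[OF _ that]) (simp_all add: p(1) p(2)[symmetric])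
  have Tnorm: "norm (T y) \<le> norm y" for y
    using contr[of "fst (p y)" "snd (p y)"] p(1) unfolding T_def by (simp flip: p(2))
  have cl: "bounded_clinear T"
  proof (rule bounded_clinearI[where K = 1])
    fix x y
    have "(fst (p x) + fst (p y), snd (p x) + snd (p y)) \<in> G"
      by (rule G'(2)) (simp_all add: p(1))
    from T[OF this] have "T ((fst (p x) + snd (p x)) + (fst (p y) + snd (p y)))
        = (fst (p x) - snd (p x)) + (fst (p y) - snd (p y))" by (simp add: algebra_simps)
    then show "T (x + y) = T x + T y" by (simp only: p(2)[symmetric] T_def[symmetric])
  next
    fix c y
    have "(c *\<^sub>C fst (p y), c *\<^sub>C snd (p y)) \<in> G"
      by (rule G'(4)) (simp add: p(1))
    from T[OF this] have "T (c *\<^sub>C (fst (p y) + snd (p y))) = c *\<^sub>C (fst (p y) - snd (p y))"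
      by (simp only: scaleC_add_right scaleC_diff_right)
    then show "T (c *\<^sub>C y) = c *\<^sub>C T y" by (simp only: p(2)[symmetric] T_def[symmetric])
  qed (simp add: Tnorm)
  have sym: "cinner g f' = cinner f g'" if "(f, g) \<in> G" "(f', g') \<in> G" for f g f' g'
  proof -
    have "(f', g') \<in> adjoint_op G" using that(2) adj by simp
    then show ?thesis using that(1) by (auto simp: adjoint_op_def)
  qed
  have "cinner (T x) y = cinner x (T y)" for x y
  proof -
    obtain f g f' g' where fg: "(f, g) \<in> G" "x = f + g" "(f', g') \<in> G" "y = f' + g'"
      using range_one_plus_nonneg[OF assms, of x] range_one_plus_nonneg[OF assms, of y] by blast
    then show ?thesis
      using sym[OF fg(1,3)] by (simp add: T cinner_simps)
  qed
  then have sa: "bounded_selfadjoint T" by (rule bounded_selfadjointI[OF cl])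
  have "G = cayley_graph T"
  proof (rule antisym; clarify)
    fix f g assume fg: "(f, g) \<in> G"
    define x where "x = (1/2) *\<^sub>R (f + g)"
    have Tx: "T x = (1/2) *\<^sub>R (f - g)" by (simp add: x_def bounded_clinear_scaleR[OF cl] T[OF fg])
    have "x + T x = (1/2) *\<^sub>R (f + f)" "x - T x = (1/2) *\<^sub>R (g + g)"
      unfolding Tx unfolding x_def scaleR_add_right[symmetric] scaleR_diff_right[symmetric] by simp_all
    then show "(f, g) \<in> cayley_graph T" using cayley_graphI[of x T] by (simp only: half_sum)
  next
    fix f g assume "(f, g) \<in> cayley_graph T"
    then obtain x where fgx: "f = x + T x" "g = x - T x" by (rule cayley_graphE)
    obtain a b where ab: "(a, b) \<in> G" "x = a + b"
      using range_one_plus_nonneg[OF assms, of x] by blast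
    have "f = a + a" "g = b + b" using fgx T[OF ab(1)] ab(2) by simp_all
    then show "(f, g) \<in> G" using G'(2)[OF ab(1) ab(1)] by simp
  qed
  then show thesis using that sa Tnorm by blast
qed

lemma op_app_eq: "single_valued G \<Longrightarrow> (f, g) \<in> G \<Longrightarrow> op_app G f = g"
  unfolding op_app_def by (rule the_equality) (auto dest: single_valuedD)

lemma nonneg_of_positive_op:
  fixes G :: "'a::complex_inner graph"
  assumes "positive_op G" "single_valued G" "(f, g) \<in> G"
  shows "0 \<le> Re (cinner g f)"
  using assms op_app_eq[OF assms(2,3)] unfolding positive_op_def
  by (cases "f = 0") (auto simp: Domain_iff intro: less_imp_le)

lemma single_valued_cayley_graph:
  assumes "bounded_clinear T" "\<And>x. x + T x = 0 \<Longrightarrow> x = 0"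
  shows "single_valued (cayley_graph T)"
proof (rule single_valuedI)
  fix f g g' assume "(f, g) \<in> cayley_graph T" "(f, g') \<in> cayley_graph T"
  then obtain x y where xy: "f = x + T x" "g = x - T x" "f = y + T y" "g' = y - T y"
    by (metis cayley_graphE)
  have "(x - y) + T (x - y) = (x + T x) - (y + T y)"
    by (simp add: bounded_clinear_diff[OF assms(1)])
  also have "\<dots> = 0" using xy by simp
  finally have "x = y" using assms(2)[of "x - y"] by simp
  then show "g = g'" using xy by simp
qed

text \<open>
  For \<open>f = x + T x\<close> one has \<open>(G f, f) = \<parallel>x\<parallel>\<^sup>2 - \<parallel>T x\<parallel>\<^sup>2\<close>, so \<open>f \<mapsto> (I - T\<^sup>2)\<^sup>1\<^sup>/\<^sup>2 x\<close> is an
  isometry of the energy space into the Hilbert space.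
\<close>

lemma dense_cayley_iff:
  fixes T :: "'a::chilbert_space \<Rightarrow> 'a"
  assumes T: "bounded_selfadjoint T" "\<And>x. norm (T x) \<le> norm x"
    and inj: "\<And>x. x + T x = 0 \<Longrightarrow> x = 0"
  shows "dense_in_energy_completion ((\<lambda>x. x + T x) ` S) (cayley_graph T)
    \<longleftrightarrow> null_modulo (norm_defect T) S"
proof -
  let ?G = "cayley_graph T"
  note clT = bounded_selfadjoint_clinear[OF T(1)]
  note sv = single_valued_cayley_graph[OF clT inj]
  have injc: "x = y" if "x + T x = y + T y" for x y
    using inj[of "x - y"] that by (simp add: bounded_clinear_diff[OF clT] algebra_simps)
  have R: "bounded_selfadjoint (\<lambda>x. x - T (T x))" by (intro bsa_intros bsa_square T)
  have qR: "qform (\<lambda>x. x - T (T x)) x = norm_defect T x" for x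
    by (simp add: qform_def norm_defect_def cinner_simps norm_sq_cinner bounded_selfadjoint_cinner[OF T(1)])
  have R0: "0 \<le> qform (\<lambda>x. x - T (T x)) x" for x
    unfolding qR norm_defect_def using power_mono[OF T(2)[of x], of 2] by simp
  obtain U where U: "bounded_selfadjoint U" "\<And>x. U (U x) = x - T (T x)"
    by (rule positive_sqrt_exists[OF R R0]) blast
  note clU = bounded_selfadjoint_clinear[OF U(1)]
  have Un: "norm (U x) = sqrt (norm_defect T x)" for x
    using norm_sqrt[of U "\<lambda>x. x - T (T x)" x, OF U] unfolding qR
    by (metis norm_ge_zero real_sqrt_unique)
  have app: "op_app ?G (x + T x) = x - T x" for x by (rule op_app_eq[OF sv cayley_graphI])
  have en: "energy_norm ?G (x + T x) = sqrt (norm_defect T x)" for x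
    by (simp add: energy_norm_def energy_inner_def app cayley_form norm_defect_def)
  have diff: "(x + T x) - (y + T y) = (x - y) + T (x - y)" for x y
    by (simp add: bounded_clinear_diff[OF clT])
  define D where "D f = U (THE x. f = x + T x)" for f
  have D: "D (x + T x) = U x" for x
    unfolding D_def by (rule arg_cong[where f = U], rule the_equality) (auto dest: injc)
  have iso: "energy_norm ?G (f - g) = norm (D f - D g)" if "f \<in> Domain ?G" "g \<in> Domain ?G" for f g
    using that unfolding Domain_cayley_graph
    by (auto simp: D diff en Un simp flip: bounded_clinear_diff[OF clU])
  have "dense_in_energy_completion ((\<lambda>x. x + T x) ` S) ?G \<longleftrightarrow>
      (\<forall>x. \<forall>e>0. \<exists>s\<in>S. sqrt (norm_defect T (x - s)) < e)"
    by (subst dense_in_energy_completion_iff[where D = D, OF iso])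
      (auto simp: Domain_cayley_graph diff en)
  also have "\<dots> \<longleftrightarrow> null_modulo (norm_defect T) S"
    unfolding null_modulo_def
  proof (intro iffI allI impI)
    fix x and e :: real
    assume *: "\<forall>x. \<forall>e>0. \<exists>s\<in>S. sqrt (norm_defect T (x - s)) < e" and "0 < e"
    then obtain s where "s \<in> S" "sqrt (norm_defect T (x - s)) < sqrt e"
      using real_sqrt_gt_zero by blast
    then show "\<exists>s\<in>S. norm_defect T (x - s) < e" by auto
  next
    fix x and e :: real
    assume *: "\<forall>x. \<forall>e>0. \<exists>s\<in>S. norm_defect T (x - s) < e" and "0 < e"
    then obtain s where "s \<in> S" "norm_defect T (x - s) < e\<^sup>2"
      using zero_less_power by blast
    then show "\<exists>s\<in>S. sqrt (norm_defect T (x - s)) < e"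
      using \<open>0 < e\<close> real_less_lsqrt[of e "norm_defect T (x - s)"]
      by (intro bexI[of _ s]) (auto simp: real_sqrt_less_iff intro: real_less_lsqrt)
  qed
  finally show ?thesis .
qed

section \<open>Extensions belonging to dual definite subspaces\<close>

locale dual_definite_pair =
  fixes J :: "'a::chilbert_space \<Rightarrow> 'a" and Lp Lm :: "'a set"
  assumes fundamental: "fundamental_symmetry J"
    and dual: "dual_definite J Lp Lm"
    and dense: "closure {f + g |f g. f \<in> Lp \<and> g \<in> Lm} = UNIV"
begin

abbreviation "T0 \<equiv> T_zero J Lp Lm"
abbreviation "G0 \<equiv> G_zero J Lp Lm"
abbreviation "S \<equiv> Domain T0"
abbreviation "Tmin \<equiv> T_mu J Lp Lm"
abbreviation "Tmax \<equiv> T_M J Lp Lm"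

lemma J_bsa: "bounded_selfadjoint J" and JJ [simp]: "J (J x) = x"
  using fundamental by (auto simp: fundamental_symmetry_def)

lemmas J_cl = bounded_selfadjoint_clinear[OF J_bsa]
lemmas J_add = bounded_clinear_add[OF J_cl]
lemmas J_diff = bounded_clinear_diff[OF J_cl]
lemmas J_minus = bounded_clinear_minus[OF J_cl]
lemmas J_scaleR = bounded_clinear_scaleR[OF J_cl]
lemmas J_cinner = bounded_selfadjoint_cinner[OF J_bsa]

lemma norm_J [simp]: "norm (J x) = norm x"
proof -
  have "(norm (J x))\<^sup>2 = (norm x)\<^sup>2" by (simp add: norm_sq_cinner J_cinner)
  then show ?thesis by (simp add: power2_eq_iff_nonneg)
qed

lemma Lm_sub: "csubspace Lm"
  using dual by (auto simp: dual_definite_def closed_csubspace_def)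

lemma orth: "f \<in> Lp \<Longrightarrow> g \<in> Lm \<Longrightarrow> cinner (J f) g = 0"
  using dual by (auto simp: dual_definite_def krein_inner_def)

lemma orth': "f \<in> Lp \<Longrightarrow> g \<in> Lm \<Longrightarrow> cinner (J g) f = 0"
  by (metis orth J_cinner cinner_commute complex_cnj_zero)

text \<open>
  The graph of \<open>T\<^sub>0\<close> is the image of \<open>Lp \<times> Lm\<close> under \<open>(f, g) \<mapsto> (x, y)\<close> with
  \<open>x + y = f + g\<close> and \<open>x - y = J (f - g)\<close>. In these coordinates symmetry, contractivity
  and closedness are read off from the properties of \<open>Lp\<close> and \<open>Lm\<close>.
\<close>

lemma T_zero_iff:
  "(x, y) \<in> T0 \<longleftrightarrow>
     (1/2) *\<^sub>R (x + y + J (x - y)) \<in> Lp \<and> (1/2) *\<^sub>R (x + y - J (x - y)) \<in> Lm"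
proof
  assume "(x, y) \<in> T0"
  then obtain f g where fg: "f \<in> Lp" "g \<in> Lm"
    "x = P_plus J f + P_minus J g" "y = P_minus J f + P_plus J g"
    by (auto simp: T_zero_def K_plus_def K_minus_def)
  have half2: "(1/2) *\<^sub>R (a + b) + (1/2) *\<^sub>R (a - b) = a" "(1/2) *\<^sub>R (a + b) - (1/2) *\<^sub>R (a - b) = b"
    for a b :: 'a
    unfolding scaleR_add_right[symmetric] scaleR_diff_right[symmetric] by (simp_all add: half_sum)
  have PQ: "P_plus J h + P_minus J h = h" "P_plus J h - P_minus J h = J h" for h
    unfolding P_plus_def P_minus_def by (rule half2)+
  have "x + y = (P_plus J f + P_minus J f) + (P_plus J g + P_minus J g)"
    unfolding fg by (simp add: algebra_simps)
  also have "\<dots> = f + g" unfolding PQ ..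
  finally have sum: "x + y = f + g" .
  have "x - y = (P_plus J f - P_minus J f) - (P_plus J g - P_minus J g)"
    unfolding fg by (simp add: algebra_simps)
  also have "\<dots> = J (f - g)" unfolding PQ J_diff ..
  finally have "J (x - y) = f - g" by simp
  then have "(1/2) *\<^sub>R (x + y + J (x - y)) = (1/2) *\<^sub>R (f + f)"
    "(1/2) *\<^sub>R (x + y - J (x - y)) = (1/2) *\<^sub>R (g + g)"
    using sum by simp_all
  then show "(1/2) *\<^sub>R (x + y + J (x - y)) \<in> Lp \<and> (1/2) *\<^sub>R (x + y - J (x - y)) \<in> Lm"
    unfolding half_sum using fg by simp
next
  assume fg: "(1/2) *\<^sub>R (x + y + J (x - y)) \<in> Lp \<and> (1/2) *\<^sub>R (x + y - J (x - y)) \<in> Lm"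
  define f g where "f = (1/2) *\<^sub>R (x + y + J (x - y))" and "g = (1/2) *\<^sub>R (x + y - J (x - y))"
  have "x = P_plus J f + P_minus J g" "y = P_minus J f + P_plus J g"
    unfolding P_plus_def P_minus_def f_def g_def
    by (simp_all add: J_add J_diff J_scaleR scaleR_add_right scaleR_diff_right
        flip: scaleR_left_distrib)
  moreover have "f \<in> Lp" "g \<in> Lm" using fg by (simp_all add: f_def g_def)
  ultimately show "(x, y) \<in> T0"
    unfolding T_zero_def K_plus_def K_minus_def by blast
qed

lemma T_zero_coordinates:
  assumes "(x, y) \<in> T0"
  obtains f g where "f \<in> Lp" "g \<in> Lm" "x + y = f + g" "x - y = J (f - g)"
proof
  let ?f = "(1/2) *\<^sub>R (x + y + J (x - y))" and ?g = "(1/2) *\<^sub>R (x + y - J (x - y))"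
  show "?f \<in> Lp" "?g \<in> Lm" using assms T_zero_iff by blast+
  have "?f + ?g = (1/2) *\<^sub>R ((x + y) + (x + y))"
    unfolding scaleR_add_right[symmetric] by simp
  then show "x + y = ?f + ?g" by (simp only: half_sum)
  have "?f - ?g = (1/2) *\<^sub>R (J (x - y) + J (x - y))"
    unfolding scaleR_diff_right[symmetric] by simp
  then have "?f - ?g = J (x - y)" by (simp only: half_sum)
  then show "x - y = J (?f - ?g)" by (simp del: scaleR_diff_right)
qed

lemma T_zero_from_coordinates:
  assumes "f \<in> Lp" "g \<in> Lm"
  shows "\<exists>x y. (x, y) \<in> T0 \<and> x + y = f + g"
proof -
  define x y where "x = (1/2) *\<^sub>R (f + g + J (f - g))" and "y = (1/2) *\<^sub>R (f + g - J (f - g))"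
  have "x + y = (1/2) *\<^sub>R ((f + g) + (f + g))" "x - y = (1/2) *\<^sub>R (J (f - g) + J (f - g))"
    unfolding x_def y_def scaleR_add_right[symmetric] scaleR_diff_right[symmetric] by simp_all
  then have xy: "x + y = f + g" "x - y = J (f - g)" by (simp_all only: half_sum)
  have "(1/2) *\<^sub>R (x + y + J (x - y)) = (1/2) *\<^sub>R (f + f)"
    "(1/2) *\<^sub>R (x + y - J (x - y)) = (1/2) *\<^sub>R (g + g)"
    by (simp_all add: xy)
  then have "(x, y) \<in> T0" using assms by (simp only: T_zero_iff half_sum)
  then show ?thesis using xy(1) by blast
qed

lemma T_zero_symmetric_contraction: "symmetric_contraction T0"
proof -
  have hom: "J (c *\<^sub>C a - c *\<^sub>C b) = c *\<^sub>C J (a - b)" for c a b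
    by (simp add: bounded_clinear_scaleC[OF J_cl] flip: scaleC_diff_right)
  have "bounded_clinear (\<lambda>p::'a \<times> 'a. (1/2) *\<^sub>R (fst p + snd p + J (fst p - snd p)))"
    "bounded_clinear (\<lambda>p::'a \<times> 'a. (1/2) *\<^sub>R (fst p + snd p - J (fst p - snd p)))"
    using J_cl unfolding bounded_clinear_def
    by (auto simp: scaleC_prod_def scaleC_add_right scaleC_diff_right scaleC_scaleR hom
        intro!: bounded_linear_const_scaleR bounded_linear_add bounded_linear_sub
          bounded_linear_fst bounded_linear_snd bounded_linear_compose[of J])
  then have "closed_csubspace ((\<lambda>p. (1/2) *\<^sub>R (fst p + snd p + J (fst p - snd p))) -` Lp)"
    "closed_csubspace ((\<lambda>p. (1/2) *\<^sub>R (fst p + snd p - J (fst p - snd p))) -` Lm)"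
    using dual by (auto intro!: closed_csubspace_vimage simp: dual_definite_def)
  then have "closed_csubspace ((\<lambda>p. (1/2) *\<^sub>R (fst p + snd p + J (fst p - snd p))) -` Lp \<inter>
      (\<lambda>p. (1/2) *\<^sub>R (fst p + snd p - J (fst p - snd p))) -` Lm)"
    unfolding closed_csubspace_def csubspace_def by (simp add: closed_Int)
  also have "\<dots> = T0" using T_zero_iff by (auto simp del: scaleR_diff_right scaleR_add_right)
  finally have "closed_csubspace T0" .
  moreover have "norm y \<le> norm x" if xy: "(x, y) \<in> T0" for x y
  proof -
    obtain f g where fg: "f \<in> Lp" "g \<in> Lm" "x + y = f + g" "x - y = J (f - g)"
      by (rule T_zero_coordinates[OF xy])
    have "(norm x)\<^sup>2 - (norm y)\<^sup>2 = Re (cinner (J (f - g)) (f + g))"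
      using cayley_form[of x y] fg by simp
    also have "\<dots> = Re (krein_inner J f f) - Re (krein_inner J g g)"
      using orth[OF fg(1,2)] orth'[OF fg(1,2)] by (simp add: J_diff cinner_simps krein_inner_def)
    also have "\<dots> \<ge> 0"
    proof -
      have "0 \<le> Re (krein_inner J f f)" "Re (krein_inner J g g) \<le> 0"
        using dual fg(1,2) unfolding dual_definite_def
        by (cases "f = 0"; cases "g = 0"; force simp: krein_inner_def intro: less_imp_le)+
      then show ?thesis by simp
    qed
    finally show ?thesis by (simp add: abs_le_square_iff[symmetric])
  qed
  moreover have "cinner y x' = cinner x y'" if xy: "(x, y) \<in> T0" "(x', y') \<in> T0" for x y x' y'
  proof -
    obtain f g where fg: "f \<in> Lp" "g \<in> Lm" "x + y = f + g" "x - y = J (f - g)"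
      by (rule T_zero_coordinates[OF xy(1)])
    obtain f' g' where fg': "f' \<in> Lp" "g' \<in> Lm" "x' + y' = f' + g'" "x' - y' = J (f' - g')"
      by (rule T_zero_coordinates[OF xy(2)])
    have "2 * (cinner y x' - cinner x y') = cinner (x + y) (x' - y') - cinner (x - y) (x' + y')"
      by (simp add: cinner_simps)
    also have "\<dots> = cinner (f + g) (J (f' - g')) - cinner (J (f - g)) (f' + g')"
      by (simp only: fg fg')
    also have "\<dots> = 0"
      using orth[OF fg(1) fg'(2)] orth'[OF fg'(1) fg(2)]
      by (simp add: J_add J_diff cinner_simps J_cinner[symmetric])
    finally show ?thesis by simp
  qed
  ultimately show ?thesis unfolding symmetric_contraction_def by blast
qed

lemma T_zero_J: 
  assumes "(x, y) \<in> T0"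
  shows "(J x, - J y) \<in> T0"
proof -
  have fg: "(1/2) *\<^sub>R (x + y + J (x - y)) \<in> Lp" "(1/2) *\<^sub>R (x + y - J (x - y)) \<in> Lm"
    using assms T_zero_iff by blast+
  have "J x + (- J y) + J (J x - - J y) = x + y + J (x - y)"
    "J x + (- J y) - J (J x - - J y) = - (x + y - J (x - y))"
    by (simp_all add: J_add J_diff)
  then show ?thesis
    unfolding T_zero_iff using fg(1) csubspace_minus[OF Lm_sub fg(2)] by (simp only: scaleR_minus_right)
qed

lemma G_zero_eq: "G0 = {(x + y, x - y) |x y. (x, y) \<in> T0}"
proof -
  have "y = y'" if "(x, y) \<in> T0" "(x, y') \<in> T0" for x y y'
    using symmetric_contraction_unique[OF T_zero_symmetric_contraction that] .
  then show ?thesis unfolding G_zero_def by blast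
qed

lemma Domain_G_zero: "Domain G0 = {x + y |x y. (x, y) \<in> T0}"
  unfolding G_zero_eq by blast

lemma closure_Domain_G_zero: "closure (Domain G0) = UNIV"
proof -
  have "{f + g |f g. f \<in> Lp \<and> g \<in> Lm} \<subseteq> Domain G0"
    unfolding Domain_G_zero using T_zero_from_coordinates by (auto) (metis)
  from closure_mono[OF this] dense show ?thesis by blast
qed

definition extension :: "('a \<Rightarrow> 'a) \<Rightarrow> bool" where
  "extension T \<longleftrightarrow> T \<in> sa_contractive_extensions T0"

lemma extensionD:
  assumes "extension T"
  shows "bounded_selfadjoint T" "norm (T x) \<le> norm x" "(x, y) \<in> T0 \<Longrightarrow> T x = y"
  using assms by (auto simp: extension_def sa_contractive_extensions_def)

lemma extension_J:
  assumes "extension T"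
  shows "extension (\<lambda>x. - J (T (J x)))"
proof -
  note T = extensionD[OF assms]
  have "- J (T (J x)) = y" if "(x, y) \<in> T0" for x y
    using T(3)[OF T_zero_J[OF that]] by (simp add: J_minus)
  then show ?thesis
    unfolding extension_def sa_contractive_extensions_def
    using bsa_minus[OF bsa_conj[OF T(1) J_bsa]] T(2)[of "J x" for x] by auto
qed

text \<open>The kernel of \<open>I + T\<close> is orthogonal to the range of \<open>I + T\<^sub>0\<close>, which is dense.\<close>

lemma extension_inj:
  assumes "extension T" and x: "x + T x = 0"
  shows "x = 0"
proof -
  note T = extensionD[OF assms(1)]
  have orth: "cinner w x = 0" if w: "w \<in> Domain G0" for w
  proof -
    obtain s t where st: "(s, t) \<in> T0" "w = s + t" using w unfolding Domain_G_zero by blast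
    have "cinner w x = cinner s (x + T x)"
      using T(3)[OF st(1)] bounded_selfadjoint_cinner[OF T(1), of s x]
      by (simp add: st(2) cinner_simps)
    then show ?thesis using x by simp
  qed
  obtain w where w: "\<And>n. w n \<in> Domain G0" "w \<longlonglongrightarrow> x"
    using closure_Domain_G_zero unfolding closure_sequential[symmetric]
    by (metis UNIV_I closure_sequential)
  have "(\<lambda>n. cinner (w n) x) \<longlonglongrightarrow> cinner x x" by (intro tendsto_cinner w tendsto_const)
  then have "cinner x x = 0" using orth[OF w(1)] by (simp add: LIMSEQ_const_iff)
  then show ?thesis by (simp add: cinner_self)
qed

text \<open>
  Equality of the norms gives \<open>T\<^sup>2 x = x\<close>, so \<open>x + T x\<close> is fixed by \<open>T\<close>. Then \<open>J\<close> maps it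
  into the kernel of \<open>I + T'\<close> for the extension \<open>T' = - J T J\<close>, which is trivial.
\<close>

lemma extension_strict:
  assumes "extension T" "norm (T x) = norm x"
  shows "x = 0"
proof -
  note T = extensionD[OF assms(1)]
  note clT = bounded_selfadjoint_clinear[OF T(1)]
  have q: "qform (\<lambda>x. x - T (T x)) y = norm_defect T y" for y
    by (simp add: qform_def norm_defect_def cinner_simps norm_sq_cinner
        bounded_selfadjoint_cinner[OF T(1)])
  have "x - T (T x) = 0"
  proof (rule qform_zero_imp_kernel[OF bsa_diff[OF bsa_id bsa_square[OF T(1)]]])
    show "0 \<le> qform (\<lambda>x. x - T (T x)) y" for y
      unfolding q norm_defect_def using power_mono[OF T(2)[of y], of 2] by simp
    show "qform (\<lambda>x. x - T (T x)) x = 0"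
      unfolding q by (simp add: norm_defect_def assms(2))
  qed
  then have TT: "T (T x) = x" by simp
  have "J (x + T x) = 0"
    by (rule extension_inj[OF extension_J[OF assms(1)]])
      (simp add: J_add bounded_clinear_add[OF clT] TT)
  then have "x + T x = 0" by (metis JJ bounded_clinear_zero[OF J_cl])
  then show ?thesis by (rule extension_inj[OF assms(1)])
qed

lemma positive_extension_cayley:
  assumes "extension T"
  shows "positive_sa_extension G0 (cayley_graph T)"
proof -
  note T = extensionD[OF assms]
  note clT = bounded_selfadjoint_clinear[OF T(1)]
  have sv: "single_valued (cayley_graph T)"
    by (rule single_valued_cayley_graph[OF clT extension_inj[OF assms]])
  have sub: "G0 \<subseteq> cayley_graph T"
    unfolding G_zero_eq cayley_graph_def using T(3) by force
  have "closure (Domain (cayley_graph T)) = UNIV"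
    using closure_mono[OF Domain_mono[OF sub]] closure_Domain_G_zero by blast
  then have "selfadjoint_op (cayley_graph T)"
    unfolding selfadjoint_op_def linear_op_def
    by (intro conjI csubspace_cayley_graph[OF clT] sv adjoint_cayley_graph[OF T(1)])
  moreover have "positive_op (cayley_graph T)"
    unfolding positive_op_def Domain_cayley_graph
  proof (intro ballI impI)
    fix f assume "f \<in> range (\<lambda>x. x + T x)" "f \<noteq> 0"
    then obtain x where x: "f = x + T x" by blast
    have "x \<noteq> 0" using x \<open>f \<noteq> 0\<close> by (auto simp: bounded_clinear_zero[OF clT])
    then have "norm (T x) < norm x"
      using extension_strict[OF assms, of x] T(2)[of x] by linarith
    then have "(norm (T x))\<^sup>2 < (norm x)\<^sup>2" by (simp add: power_strict_mono)
    then show "0 < Re (cinner (op_app (cayley_graph T) f) f)"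
      unfolding x op_app_eq[OF sv cayley_graphI[of x T]] by (simp add: cayley_form)
  qed
  ultimately show ?thesis using sub by (simp add: positive_sa_extension_def)
qed

lemma cayley_of_positive_extension:
  assumes "positive_sa_extension G0 G"
  obtains T where "extension T" "G = cayley_graph T"
proof -
  have G: "G0 \<subseteq> G" "csubspace G" "single_valued G" "adjoint_op G = G" "positive_op G"
    using assms by (auto simp: positive_sa_extension_def selfadjoint_op_def linear_op_def)
  obtain T where T: "bounded_selfadjoint T" "\<And>x. norm (T x) \<le> norm x" "G = cayley_graph T"
    by (rule cayley_of_nonneg[OF G(2,4) nonneg_of_positive_op[OF G(5,3)]]) blast+
  note clT = bounded_selfadjoint_clinear[OF T(1)]
  have "T x = y" if "(x, y) \<in> T0" for x y
  proof -
    have "(x + y, x - y) \<in> cayley_graph T"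
      using G(1) that unfolding G_zero_eq T(3) by blast
    then obtain z where z: "x + y = z + T z" "x - y = z - T z" by (rule cayley_graphE)
    have "(x + y) + (x - y) = (z + T z) + (z - T z)" "(x + y) - (x - y) = (z + T z) - (z - T z)"
      by (simp_all only: z)
    then have "x + x = z + z" "y + y = T z + T z" by simp_all
    then have "x = z" "y = T z" by (metis half_sum)+
    then show ?thesis by simp
  qed
  then have "extension T" using T by (auto simp: extension_def sa_contractive_extensions_def)
  then show thesis using that T(3) by blast
qed

text \<open>
  On \<open>(f, g) = (x + T x, x - T x)\<close> exchanging the components is the passage from \<open>T\<close> to
  \<open>- T\<close>, and applying \<open>J\<close> to both is conjugation of \<open>T\<close> with \<open>J\<close>.
\<close>

lemma cayley_J_iff:
  assumes "extension T"
  shows "(\<forall>f\<in>Domain (cayley_graph T). (J f, J (op_app (cayley_graph T) f)) \<in> (cayley_graph T)\<inverse>)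
    \<longleftrightarrow> (\<forall>x. T (J x) = - J (T x))"
proof -
  note T = extensionD[OF assms]
  note clT = bounded_selfadjoint_clinear[OF T(1)]
  have sv: "single_valued (cayley_graph T)"
    by (rule single_valued_cayley_graph[OF clT extension_inj[OF assms]])
  have app: "op_app (cayley_graph T) (x + T x) = x - T x" for x by (rule op_app_eq[OF sv cayley_graphI])
  have "(J (x - T x), J (x + T x)) \<in> cayley_graph T \<longleftrightarrow> T (J x) = - J (T x)" for x
  proof
    assume "(J (x - T x), J (x + T x)) \<in> cayley_graph T"
    then obtain z where z: "J (x - T x) = z + T z" "J (x + T x) = z - T z" by (rule cayley_graphE)
    have "J (x - T x) + J (x + T x) = (z + T z) + (z - T z)"
      "J (x + T x) - J (x - T x) = (z - T z) - (z + T z)"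
      by (simp_all only: z)
    then have "J x + J x = z + z" "J (T x) + J (T x) = - T z + - T z" by (simp_all add: J_add J_diff)
    then have "J x = z" "J (T x) = - T z" by (metis half_sum)+
    then show "T (J x) = - J (T x)" by simp
  next
    assume eq: "T (J x) = - J (T x)"
    have "J (x - T x) = J x + T (J x)" "J (x + T x) = J x - T (J x)"
      by (simp_all add: eq J_add J_diff)
    then show "(J (x - T x), J (x + T x)) \<in> cayley_graph T"
      using cayley_graphI[of "J x" T] by simp
  qed
  then show ?thesis by (simp add: Domain_cayley_graph app)
qed

lemma quasi_maximal_iff:
  "quasi_maximal J Lp Lm \<longleftrightarrow>
    (\<exists>T. extension T \<and> (\<forall>x. T (J x) = - J (T x)) \<and> null_modulo (norm_defect T) S)"
proof -
  have D: "Domain G0 = (\<lambda>x. x + T x) ` S" if "extension T" for T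
    unfolding Domain_G_zero using extensionD(3)[OF that] by (force simp: Domain_iff)
  have dense_iff: "dense_in_energy_completion (Domain G0) (cayley_graph T) \<longleftrightarrow> null_modulo (norm_defect T) S"
    if "extension T" for T
    unfolding D[OF that]
    by (rule dense_cayley_iff[OF extensionD(1,2)[OF that] extension_inj[OF that]])
  show ?thesis
  proof
    assume "quasi_maximal J Lp Lm"
    then obtain G where G: "positive_sa_extension G0 G"
      "\<forall>f\<in>Domain G. (J f, J (op_app G f)) \<in> G\<inverse>"
      "dense_in_energy_completion (Domain G0) G"
      unfolding quasi_maximal_def by blast
    obtain T where T: "extension T" "G = cayley_graph T"
      by (rule cayley_of_positive_extension[OF G(1)])
    show "\<exists>T. extension T \<and> (\<forall>x. T (J x) = - J (T x)) \<and> null_modulo (norm_defect T) S"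
      using T(1) G(2,3) unfolding T(2) cayley_J_iff[OF T(1)] dense_iff[OF T(1)] by blast
  next
    assume "\<exists>T. extension T \<and> (\<forall>x. T (J x) = - J (T x)) \<and> null_modulo (norm_defect T) S"
    then obtain T where T: "extension T" "\<forall>x. T (J x) = - J (T x)" "null_modulo (norm_defect T) S"
      by blast
    show "quasi_maximal J Lp Lm"
      unfolding quasi_maximal_def
      using positive_extension_cayley[OF T(1)] T(2,3) cayley_J_iff[OF T(1)] dense_iff[OF T(1)] by blast
  qed
qed

end

section \<open>Factorization below a positive operator\<close>

lemma csubspace_range: "bounded_clinear T \<Longrightarrow> csubspace (range T)"
  by (rule csubspace_image[OF csubspace_UNIV bounded_clinear_clinear_on])

lemma closed_csubspace_closure: "csubspace L \<Longrightarrow> closed_csubspace (closure L)"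
  by (simp add: closed_csubspace_def csubspace_closure)

text \<open>A positive operator and its square root have the same kernel, hence the same closed range.\<close>

lemma closure_range_sqrt:
  fixes V :: "'a::chilbert_space \<Rightarrow> 'a"
  assumes V: "bounded_selfadjoint V" "\<And>x. V (V x) = R x"
  shows "closure (range R) = closure (range V)"
proof
  have "range R \<subseteq> range V" using V(2) by (metis image_subset_iff rangeI)
  then show "closure (range R) \<subseteq> closure (range V)" by (rule closure_mono)
next
  have R: "bounded_selfadjoint R"
    using bsa_square[OF V(1)] by (simp add: V(2))
  obtain P where P: "bounded_selfadjoint P" "\<And>x. P x \<in> closure (range R)"
    "\<And>x. x \<in> closure (range R) \<Longrightarrow> P x = x"
    by (rule orthogonal_projection_exists[OF closed_csubspace_closure[OF
            csubspace_range[OF bounded_selfadjoint_clinear[OF R]]]]) blast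
  note clP = bounded_selfadjoint_clinear[OF P(1)]
  have "V x \<in> closure (range R)" for x
  proof -
    define z where "z = V x - P (V x)"
    have PR: "P (R y) = R y" for y by (rule P(3)[OF subsetD[OF closure_subset rangeI]])
    have PP: "P (P y) = P y" for y by (rule P(3)[OF P(2)])
    have "cinner w (R z) = cinner w 0" for w
      by (simp add: z_def cinner_simps bounded_selfadjoint_cinner[OF R, symmetric]
          bounded_selfadjoint_cinner[OF P(1), symmetric] PR)
    then have Rz: "R z = 0" by (rule cinner_eqI)
    have "(norm (V z))\<^sup>2 = 0" by (simp add: norm_sqrt[of V R, OF V] qform_def Rz)
    then have "V z = 0" by simp
    then have "cinner z (V x) = 0"
      by (simp add: bounded_selfadjoint_cinner[OF V(1), symmetric])
    moreover have "cinner z (P (V x)) = 0"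
      by (simp add: bounded_selfadjoint_cinner[OF P(1), symmetric] z_def bounded_clinear_diff[OF clP] PP)
    ultimately have "cinner z z = 0" by (simp add: z_def cinner_diff_right)
    then have "V x = P (V x)" by (simp add: cinner_self z_def)
    then show ?thesis using P(2) by metis
  qed
  then show "closure (range V) \<subseteq> closure (range R)"
    by (intro closure_minimal) auto
qed

text \<open>
  A self-adjoint operator with range in the closed range of \<open>V\<close> vanishes on the orthogonal
  complement of that range, so its values on the range of \<open>V\<close> determine it; by the same argument
  its compression \<open>V X V\<close> does.
\<close>

lemma bsa_vanish:
  assumes V: "bounded_selfadjoint V" and X: "bounded_selfadjoint X"
    and range: "\<And>x. X x \<in> closure (range V)" and zero: "\<And>x. X (V x) = 0"
  shows "X y = 0"
proof (rule closure_eq_by_cinner[OF csubspace_range[OF bounded_selfadjoint_clinear[OF V]] range])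
  show "0 \<in> closure (range V)"
    using csubspace_0[OF csubspace_closure[OF csubspace_range[OF bounded_selfadjoint_clinear[OF V]]]] .
next
  fix w assume "w \<in> range V"
  then show "cinner w (X y) = cinner w 0"
    using zero by (auto simp: bounded_selfadjoint_cinner[OF X, symmetric])
qed

lemma bsa_conj_vanish:
  assumes V: "bounded_selfadjoint V" and X: "bounded_selfadjoint X"
    and range: "\<And>x. X x \<in> closure (range V)" and zero: "\<And>x. V (X (V x)) = 0"
  shows "X y = 0"
proof (rule bsa_vanish[OF V X range])
  show "X (V x) = 0" for x
  proof (rule closure_eq_by_cinner[OF csubspace_range[OF bounded_selfadjoint_clinear[OF V]] range])
    show "0 \<in> closure (range V)"
      using csubspace_0[OF csubspace_closure[OF csubspace_range[OF bounded_selfadjoint_clinear[OF V]]]] .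
  next
    fix w assume "w \<in> range V"
    then show "cinner w (X (V x)) = cinner w 0"
      using zero by (auto simp: bounded_selfadjoint_cinner[OF V])
  qed
qed

text \<open>
  An operator between \<open>0\<close> and \<open>V\<^sup>2\<close> factors as \<open>V C V\<close>: its square root is
  dominated by \<open>V\<close>, so Douglas' lemma applies to it, and \<open>C = K\<^sup>* K\<close> for the
  contraction \<open>K\<close> obtained.
\<close>

lemma interval_factorization:
  fixes V :: "'a::chilbert_space \<Rightarrow> 'a"
  assumes V: "bounded_selfadjoint V" and A: "bounded_selfadjoint A"
    and bounds: "\<And>x. 0 \<le> qform A x" "\<And>x. qform A x \<le> (norm (V x))\<^sup>2"
  obtains C where "bounded_selfadjoint C" "\<And>x. A x = V (C (V x))" "\<And>x. C x \<in> closure (range V)"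
    "\<And>x. (norm (C x))\<^sup>2 \<le> qform C x"
proof -
  obtain U where U: "bounded_selfadjoint U" "\<And>x. U (U x) = A x"
    by (rule positive_sqrt_exists[OF A bounds(1)]) blast
  note clV = bounded_selfadjoint_clinear[OF V] and clU = bounded_selfadjoint_clinear[OF U(1)]
  have UV: "norm (U x) \<le> 1 * norm (V x)" for x
    using bounds(2)[of x] norm_sqrt[of U A x, OF U] by (simp add: power2_le_imp_le)
  obtain Z where Z: "bounded_clinear Z" "\<And>x y. cinner (U x) y = cinner (V x) (Z y)"
    "\<And>y. Z y \<in> closure (range V)" "\<And>y. norm (Z y) \<le> 1 * norm y"
    by (rule douglas_factorization[OF csubspace_UNIV bounded_clinear_clinear_on[OF clV]
          bounded_clinear_clinear_on[OF clU] UV]) auto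
  obtain Z' where Z': "bounded_clinear Z'" "\<And>x y. cinner (Z x) y = cinner x (Z' y)"
    by (rule adjoint_exists[OF Z(1)]) blast
  have Z'': "cinner (Z' x) y = cinner x (Z y)" for x y
    by (subst cinner_commute) (simp add: Z'(2)[symmetric] flip: cinner_commute)
  define C where "C x = Z (Z' x)" for x
  have "bounded_clinear C"
    using Z(1) Z'(1) unfolding C_def[abs_def] bounded_clinear_def
    by (auto intro: bounded_linear_compose)
  then have C: "bounded_selfadjoint C"
    by (rule bounded_selfadjointI) (simp add: C_def Z'(2) Z'')
  have "A x = V (C (V x))" for x
  proof (rule cinner_eqI)
    fix y
    have Zxy: "Z' (V w) = U w" for w
      by (rule cinner_eqI) (metis Z'(2) Z(2) cinner_commute)
    have "cinner y (A x) = cinner (U y) (U x)"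
      by (simp add: U(2)[symmetric] bounded_selfadjoint_cinner[OF U(1)])
    also have "\<dots> = cinner (V y) (Z (U x))" by (rule Z(2))
    also have "\<dots> = cinner y (V (C (V x)))"
      by (simp add: C_def Zxy bounded_selfadjoint_cinner[OF V])
    finally show "cinner y (A x) = cinner y (V (C (V x)))" .
  qed
  moreover have "(norm (C x))\<^sup>2 \<le> qform C x" for x
  proof -
    have "norm (C x) \<le> norm (Z' x)" using Z(4)[of "Z' x"] by (simp add: C_def)
    then have "(norm (C x))\<^sup>2 \<le> (norm (Z' x))\<^sup>2" by (simp add: power_mono)
    also have "\<dots> = qform C x" by (simp add: C_def qform_def Z'(2) norm_sq_cinner)
    finally show ?thesis .
  qed
  moreover have "C x \<in> closure (range V)" for x unfolding C_def by (rule Z(3))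
  ultimately show thesis using that C by blast
qed

section \<open>Projections and hypermaximal neutral subspaces\<close>

context dual_definite_pair
begin

lemma extremal: "extremal_pair T0 Tmin Tmax"
  by (rule extremal_pair_T_mu_T_M[OF T_zero_symmetric_contraction])

lemma Tmin_bsa: "bounded_selfadjoint Tmin" and Tmax_bsa: "bounded_selfadjoint Tmax"
  and Tmin_le_Tmax: "op_le Tmin Tmax"
  and Tmin_null: "null_modulo (\<lambda>x. (norm x)\<^sup>2 + qform Tmin x) S"
  and Tmax_null: "null_modulo (\<lambda>x. (norm x)\<^sup>2 - qform Tmax x) S"
  using extremal by (auto simp: extremal_pair_def)

lemma extension_iff:
  "extension T \<longleftrightarrow> bounded_selfadjoint T \<and> op_le Tmin T \<and> op_le T Tmax"
  using extremal by (simp add: extension_def extremal_pair_def op_interval_def)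

lemma Tmin_extension: "extension Tmin" and Tmax_extension: "extension Tmax"
  by (simp_all add: extension_iff Tmin_bsa Tmax_bsa Tmin_le_Tmax) (simp_all add: op_le_def)

text \<open>\<open>T \<mapsto> - J T J\<close> is an order-reversing involution of the extensions.\<close>

lemma J_Tmin: "J (Tmin (J x)) = - Tmax x"
proof -
  have neg: "qform (\<lambda>x. - J (T (J x))) x = - qform T (J x)" for T x
    by (simp add: qform_def cinner_simps J_cinner)
  have ge: "op_le Tmin (\<lambda>x. - J (Tmax (J x)))" and le: "op_le (\<lambda>x. - J (Tmin (J x))) Tmax"
    using extension_J[OF Tmax_extension] extension_J[OF Tmin_extension] by (simp_all add: extension_iff)
  have "op_le (\<lambda>x. - J (Tmax (J x))) Tmin"
    unfolding op_le_qform
  proof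
    fix x
    have "qform (\<lambda>x. - J (Tmin (J x))) (J x) \<le> qform Tmax (J x)" using le by (simp add: op_le_qform)
    then show "qform (\<lambda>x. - J (Tmax (J x))) x \<le> qform Tmin x" by (simp add: neg)
  qed
  then have "Tmin = (\<lambda>x. - J (Tmax (J x)))"
    by (rule op_le_antisym[OF Tmin_bsa bsa_minus[OF bsa_conj[OF Tmax_bsa J_bsa]] ge])
  from fun_cong[OF this, of "J x"] show ?thesis by (simp add: J_minus)
qed

lemma J_Tmax: "J (Tmax (J x)) = - Tmin x"
  using arg_cong[OF J_Tmin[of "J x"], of J] by (simp add: J_minus)

definition gap :: "'a \<Rightarrow> 'a" where
  "gap x = Tmax x - Tmin x"

lemma gap_bsa: "bounded_selfadjoint gap"
  unfolding gap_def[abs_def] by (intro bsa_intros Tmin_bsa Tmax_bsa)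

lemma qform_gap: "qform gap x = qform Tmax x - qform Tmin x"
  by (simp add: gap_def qform_def cinner_simps)

lemma gap_J: "J (gap x) = gap (J x)"
  using J_Tmin[of "J x"] J_Tmax[of "J x"] by (simp add: gap_def J_diff)

lemma gap_sqrt_exists:
  obtains V where "bounded_selfadjoint V" "\<And>x. V (V x) = gap x" "\<And>x. J (V x) = V (J x)"
    "M_space J Lp Lm = closure (range V)"
proof -
  have pos: "0 \<le> qform gap x" for x
    using Tmin_le_Tmax by (simp add: qform_gap op_le_qform)
  obtain V where V: "bounded_selfadjoint V" "\<And>x. V (V x) = gap x"
    "\<And>C x. bounded_clinear C \<Longrightarrow> (\<And>x. C (gap x) = gap (C x)) \<Longrightarrow> C (V x) = V (C x)"
    by (rule positive_sqrt_exists[OF gap_bsa pos]) blast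
  have "M_space J Lp Lm = closure (range V)"
    using closure_range_sqrt[of V gap, OF V(1,2)]
    by (simp add: M_space_def gap_def[abs_def])
  then show thesis by (rule that[OF V(1,2) V(3)[OF J_cl gap_J]])
qed

text \<open>
  The infimum over \<open>s \<in> S\<close> of the form of \<open>I + T\<close> at \<open>x - s\<close> is the form of
  \<open>T - T\<^sub>\<mu>\<close> at \<open>x\<close>, and for \<open>I - T\<close> it is that of \<open>T\<^sub>M - T\<close>. As \<open>I - T\<^sup>2\<close> is twice the parallel sum of
  \<open>I + T\<close> and \<open>I - T\<close>, its form is null modulo \<open>S\<close> exactly if the parallel sum
  of \<open>T - T\<^sub>\<mu>\<close> and \<open>T\<^sub>M - T\<close> vanishes.
\<close>

lemma null_defect_iff:
  assumes ext: "extension T"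
  shows "null_modulo (norm_defect T) S \<longleftrightarrow>
    (\<forall>x. \<forall>e>0. \<exists>u. (qform T u - qform Tmin u) + (qform Tmax (x - u) - qform T (x - u)) < e)"
proof -
  note T = extensionD[OF ext]
  have S0: "T s - Tmin s = 0" "Tmax s - T s = 0" if "s \<in> S" for s
    using that T(3) extensionD(3)[OF Tmin_extension] extensionD(3)[OF Tmax_extension]
    by (auto simp: Domain_iff)
  have lower: "qform T (x - s) - qform Tmin (x - s) = qform T x - qform Tmin x" if "s \<in> S" for x s
    using qform_kernel[OF bsa_diff[OF T(1) Tmin_bsa] S0(1)[OF that], of x]
    by (simp add: qform_def cinner_simps)
  have upper: "qform Tmax (x - s) - qform T (x - s) = qform Tmax x - qform T x" if "s \<in> S" for x s
    using qform_kernel[OF bsa_diff[OF Tmax_bsa T(1)] S0(2)[OF that], of x]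
    by (simp add: qform_def cinner_simps)
  have min_pos: "0 \<le> (norm x)\<^sup>2 + qform Tmin x" and max_pos: "0 \<le> (norm x)\<^sup>2 - qform Tmax x" for x
    using form_bounds_of_contraction[of Tmin x] form_bounds_of_contraction[of Tmax x]
      extensionD(2)[OF Tmin_extension] extensionD(2)[OF Tmax_extension]
    by (smt (verit))+
  show ?thesis
  proof (intro iffI allI impI)
    fix x and e :: real assume null: "null_modulo (norm_defect T) S" and "0 < e"
    then obtain s where s: "s \<in> S" "norm_defect T (x - s) < e"
      using null_moduloD[OF null \<open>0 < e\<close>, of x] by blast
    obtain u v where uv: "x - s = u + v"
      "(norm u)\<^sup>2 + qform T u + ((norm v)\<^sup>2 - qform T v) = norm_defect T (x - s) / 2"
      by (rule parallel_sum_minimizer[OF T(1)])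
    have v: "v = (x - u) - s" using uv(1) by (simp add: algebra_simps)
    have "0 \<le> norm_defect T (x - s)"
      unfolding norm_defect_def using power_mono[OF T(2)[of "x - s"], of 2] by simp
    then have "(qform T u - qform Tmin u) + (qform Tmax (x - u) - qform T (x - u)) < e"
      using min_pos[of u] max_pos[of v] uv(2) s(2) upper[OF s(1), of "x - u"] unfolding v by linarith
    then show "\<exists>u. (qform T u - qform Tmin u) + (qform Tmax (x - u) - qform T (x - u)) < e" ..
  next
    assume small: "\<forall>x. \<forall>e>0. \<exists>u. (qform T u - qform Tmin u) + (qform Tmax (x - u) - qform T (x - u)) < e"
    show "null_modulo (norm_defect T) S"
      unfolding null_modulo_def
    proof (intro allI impI)
      fix x and e :: real assume "0 < e"
      \<comment> \<open>three estimates by \<open>d\<close>, and the parallel sum identity halves the defect\<close>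
      define d where "d = e / 6"
      have "0 < d" using \<open>0 < e\<close> by (simp add: d_def)
      obtain u where u: "(qform T u - qform Tmin u) + (qform Tmax (x - u) - qform T (x - u)) < d"
        using small \<open>0 < d\<close> by blast
      obtain s where s: "s \<in> S" "(norm (u - s))\<^sup>2 + qform Tmin (u - s) < d"
        using null_moduloD[OF Tmin_null \<open>0 < d\<close>, of u] by blast
      obtain r where r: "r \<in> S" "(norm (x - u - r))\<^sup>2 - qform Tmax (x - u - r) < d"
        using null_moduloD[OF Tmax_null \<open>0 < d\<close>, of "x - u"] by blast
      have sum: "(u - s) + (x - u - r) = x - (s + r)" by simp
      have "norm_defect T (x - (s + r)) / 2
          \<le> (norm (u - s))\<^sup>2 + qform T (u - s) + ((norm (x - u - r))\<^sup>2 - qform T (x - u - r))"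
        using parallel_sum_identity[OF T(1), of "u - s" "x - u - r", unfolded sum]
          zero_le_power2[of "norm (u - s - (x - u - r) + T (x - (s + r)))"] by linarith
      also have "\<dots> < 3 * d"
        using lower[OF s(1), of u] upper[OF r(1), of "x - u"] u s(2) r(2) by linarith
      finally have "norm_defect T (x - (s + r)) < e" by (simp add: d_def)
      moreover have "s + r \<in> S"
        using closed_Domain[OF T_zero_symmetric_contraction] s(1) r(1)
        by (simp add: closed_csubspace_def csubspace_add)
      ultimately show "\<exists>s\<in>S. norm_defect T (x - s) < e" by blast
    qed
  qed
qed

text \<open>
  In \<open>T - T\<^sub>\<mu> = V C V\<close> the vanishing of the parallel sum makes \<open>C\<close> a projection and
  \<open>J T J = - T\<close> turns into \<open>J C J = I - C\<close> on \<open>M\<close>; so \<open>J\<close> exchanges the range of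
  \<open>C\<close> with its complement.
\<close>

lemma hypermaximal_of_quasi_maximal:
  assumes ext: "extension T" and TJ: "\<And>x. T (J x) = - J (T x)"
    and null: "null_modulo (norm_defect T) S"
  shows "\<exists>M1. hypermaximal_neutral J (M_space J Lp Lm) M1"
proof -
  note T = extensionD[OF ext]
  obtain V where V: "bounded_selfadjoint V" "\<And>x. V (V x) = gap x" "\<And>x. J (V x) = V (J x)"
    and M: "M_space J Lp Lm = closure (range V)"
    by (rule gap_sqrt_exists) blast
  note clV = bounded_selfadjoint_clinear[OF V(1)]
  have Mc: "closed_csubspace (M_space J Lp Lm)"
    unfolding M by (rule closed_csubspace_closure[OF csubspace_range[OF clV]])
  then have Msub: "csubspace (M_space J Lp Lm)" by (simp add: closed_csubspace_def)
  have VM: "V x \<in> M_space J Lp Lm" for x unfolding M by (rule subsetD[OF closure_subset rangeI])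
  have normV: "(norm (V x))\<^sup>2 = qform Tmax x - qform Tmin x" for x
    using norm_sqrt[of V gap, OF V(1,2)] by (simp add: qform_gap)
  define A where "A x = T x - Tmin x" for x
  have A: "bounded_selfadjoint A" unfolding A_def[abs_def] by (intro bsa_intros T(1) Tmin_bsa)
  have qA: "qform A x = qform T x - qform Tmin x" for x by (simp add: A_def qform_def cinner_simps)
  have "0 \<le> qform A x" "qform A x \<le> (norm (V x))\<^sup>2" for x
    using ext unfolding extension_iff op_le_qform by (simp_all add: qA normV)
  then obtain C where C: "bounded_selfadjoint C" "\<And>x. A x = V (C (V x))"
    "\<And>x. C x \<in> M_space J Lp Lm" "\<And>x. (norm (C x))\<^sup>2 \<le> qform C x"
    unfolding M by (rule interval_factorization[OF V(1) A]) blast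
  note clC = bounded_selfadjoint_clinear[OF C(1)]
  obtain Q where Q: "bounded_selfadjoint Q" "\<And>x. Q x \<in> M_space J Lp Lm"
    "\<And>x. x \<in> M_space J Lp Lm \<Longrightarrow> Q x = x"
    by (rule orthogonal_projection_exists[OF Mc]) blast
  have JM: "J x \<in> M_space J Lp Lm" if x: "x \<in> M_space J Lp Lm" for x
  proof -
    obtain f where f: "\<And>n. f n \<in> range V" "f \<longlonglongrightarrow> x"
      using x unfolding M closure_sequential by blast
    have "J (f n) \<in> range V" for n using f(1)[of n] V(3) by (metis imageE rangeI)
    then show ?thesis
      using bounded_clinear_tendsto[OF J_cl f(2)] unfolding M closure_sequential
      by (intro exI[of _ "\<lambda>n. J (f n)"]) simp
  qed
  have QM: "Q x - C x \<in> M_space J Lp Lm" for x by (rule csubspace_diff[OF Msub Q(2) C(3)])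

  have CC: "C (C x) = C x" for x
  proof -
    define X where "X x = C x - C (C x)" for x
    have X: "bounded_selfadjoint X"
      unfolding X_def[abs_def] by (intro bsa_diff bsa_square[OF C(1)] C(1))
    have qX: "qform X x = qform C x - (norm (C x))\<^sup>2" for x
      by (simp add: X_def qform_def cinner_simps norm_sq_cinner bounded_selfadjoint_cinner[OF C(1)])
    have "X (V x) = 0" for x
    proof (rule qform_zero_imp_kernel[OF X])
      show "0 \<le> qform X y" for y using C(4)[of y] by (simp add: qX)
      then have "0 \<le> qform X (V x)" .
      moreover have "qform X (V x) \<le> 0"
      proof (rule field_le_epsilon)
        fix e :: real assume "0 < e"
        then obtain w where w: "(qform T w - qform Tmin w) + (qform Tmax (x - w) - qform T (x - w)) < e"
          using null unfolding null_defect_iff[OF ext] by blast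
        let ?u = "V w" and ?v = "V (x - w)"
        have VV: "qform C (V y) = qform T y - qform Tmin y" for y
          unfolding qA[symmetric] by (simp add: qform_def C(2) bounded_selfadjoint_cinner[OF V(1)])
        \<comment> \<open>for \<open>Y = 2 C - I\<close> the parallel sum identity says that the parallel sum of
          \<open>C\<close> and \<open>I - C\<close> is \<open>C - C\<^sup>2\<close>\<close>
        define Y where "Y x = 2 *\<^sub>R C x - x" for x
        have Y: "bounded_selfadjoint Y" unfolding Y_def[abs_def] by (intro bsa_intros C(1))
        have qY: "qform Y y = 2 * qform C y - (norm y)\<^sup>2" for y
          by (simp add: Y_def qform_def cinner_simps norm_sq_cinner)
        have dY: "norm_defect Y y = 4 * qform X y" for y
          unfolding qX
          by (simp add: norm_defect_def Y_def norm_sq_diff qform_def cinner_simps power_mult_distrib)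
        have uv: "?u + ?v = V x" by (simp flip: bounded_clinear_add[OF clV])
        have "2 * qform X (V x) = norm_defect Y (?u + ?v) / 2" by (simp add: uv dY)
        also have "\<dots> \<le> (norm ?u)\<^sup>2 + qform Y ?u + ((norm ?v)\<^sup>2 - qform Y ?v)"
          using parallel_sum_identity[OF Y, of ?u ?v] by simp
        also have "\<dots> = 2 * (qform C ?u + ((norm ?v)\<^sup>2 - qform C ?v))" by (simp add: qY)
        also have "qform C ?u + ((norm ?v)\<^sup>2 - qform C ?v) < e" using w by (simp add: VV normV)
        finally show "qform X (V x) \<le> 0 + e" by simp
      qed
      ultimately show "qform X (V x) = 0" by simp
    qed
    then have "X x = 0" for x
      by (rule bsa_vanish[OF V(1) X, rotated])
        (use csubspace_diff[OF Msub C(3) C(3)] in \<open>simp add: X_def M\<close>)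
    then show ?thesis by (simp add: X_def)
  qed

  have JCJ: "J (C (J x)) = Q x - C x" for x
  proof -
    define X where "X x = J (C (J x)) - (Q x - C x)" for x
    have X: "bounded_selfadjoint X"
      unfolding X_def[abs_def] by (intro bsa_diff bsa_conj[OF C(1) J_bsa] Q(1) C(1))
    have "V (X (V x)) = 0" for x
    proof -
      have "V (J (C (J (V x)))) = J (A (J x))"
        by (simp add: V(3)[symmetric] C(2))
      also have "\<dots> = Tmax x - T x" by (simp add: A_def J_diff J_Tmin TJ J_minus)
      also have "\<dots> = gap x - A x" by (simp add: gap_def A_def)
      also have "\<dots> = V (Q (V x) - C (V x))"
        by (simp add: bounded_clinear_diff[OF clV] Q(3)[OF VM] V(2) C(2))
      finally show ?thesis by (simp add: X_def bounded_clinear_diff[OF clV])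
    qed
    then have "X x = 0"
      by (rule bsa_conj_vanish[OF V(1) X, rotated])
        (use csubspace_diff[OF Msub JM[OF C(3)] QM] in \<open>simp add: X_def M\<close>)
    then show ?thesis by (simp add: X_def)
  qed

  have CQ: "C (Q x) = C x" for x
  proof (rule cinner_eqI)
    show "cinner y (C (Q x)) = cinner y (C x)" for y
      by (simp add: bounded_selfadjoint_cinner[OF C(1), symmetric]
          bounded_selfadjoint_cinner[OF Q(1), symmetric] Q(3)[OF C(3)])
  qed
  have fixed: "range C = {x. C x = x}" using CC by auto (metis rangeI)
  have "closed_csubspace (range C)"
    unfolding closed_csubspace_def
  proof
    show "csubspace (range C)" by (rule csubspace_range[OF clC])
    have "closed {x. C x = x}"
      by (intro closed_Collect_eq linear_continuous_on bounded_clinear_bounded[OF clC] continuous_on_id)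
    then show "closed (range C)" by (simp only: fixed)
  qed
  moreover have "range C \<subseteq> M_space J Lp Lm" using C(3) by blast
  moreover have "cinner f g = 0" if fg: "f \<in> range C" "g \<in> J ` range C" for f g
  proof -
    obtain x y where xy: "f = C x" "g = J (C (J y))"
      using fg by (metis JJ imageE)
    have "cinner f g = cinner x (C (Q y - C y))"
      unfolding xy JCJ by (rule bounded_selfadjoint_cinner[OF C(1)])
    also have "C (Q y - C y) = 0" by (simp add: bounded_clinear_diff[OF clC] CQ CC)
    finally show ?thesis by simp
  qed
  moreover have "M_space J Lp Lm = {f + g |f g. f \<in> range C \<and> g \<in> J ` range C}"
  proof (intro set_eqI iffI)
    fix m assume "m \<in> M_space J Lp Lm"
    then have "m = C m + J (C (J m))" by (simp add: JCJ Q(3))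
    then show "m \<in> {f + g |f g. f \<in> range C \<and> g \<in> J ` range C}" by blast
  next
    fix m assume "m \<in> {f + g |f g. f \<in> range C \<and> g \<in> J ` range C}"
    then show "m \<in> M_space J Lp Lm" using C(3) JM csubspace_add[OF Msub] by auto
  qed
  ultimately show ?thesis unfolding hypermaximal_neutral_def by blast
qed

text \<open>
  Conversely the projection onto a hypermaximal neutral subspace is put between two copies of
  \<open>V\<close>. To split \<open>x\<close> almost optimally, \<open>V u\<close> is chosen close to the component of
  \<open>V x\<close> outside of the subspace.
\<close>

lemma quasi_maximal_of_hypermaximal:
  assumes M1: "hypermaximal_neutral J (M_space J Lp Lm) M1"
  shows "\<exists>T. extension T \<and> (\<forall>x. T (J x) = - J (T x)) \<and> null_modulo (norm_defect T) S"
proof -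
  have M1': "closed_csubspace M1" "M1 \<subseteq> M_space J Lp Lm"
    "\<And>f g. f \<in> M1 \<Longrightarrow> g \<in> M1 \<Longrightarrow> cinner f (J g) = 0"
    "\<And>m. m \<in> M_space J Lp Lm \<Longrightarrow> \<exists>f g. f \<in> M1 \<and> g \<in> M1 \<and> m = f + J g"
    using M1 unfolding hypermaximal_neutral_def by blast+
  obtain V where V: "bounded_selfadjoint V" "\<And>x. V (V x) = gap x" "\<And>x. J (V x) = V (J x)"
    and M: "M_space J Lp Lm = closure (range V)"
    by (rule gap_sqrt_exists) blast
  note clV = bounded_selfadjoint_clinear[OF V(1)]
  have Msub: "csubspace (M_space J Lp Lm)"
    unfolding M by (rule csubspace_closure[OF csubspace_range[OF clV]])
  have VM: "V x \<in> M_space J Lp Lm" for x unfolding M by (rule subsetD[OF closure_subset rangeI])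
  have normV: "(norm (V x))\<^sup>2 = qform Tmax x - qform Tmin x" for x
    using norm_sqrt[of V gap, OF V(1,2)] by (simp add: qform_gap)
  obtain C where C: "bounded_selfadjoint C" "\<And>x. C x \<in> M1" "\<And>x. x \<in> M1 \<Longrightarrow> C x = x"
    "\<And>x. norm (C x) \<le> norm x"
    by (rule orthogonal_projection_exists[OF M1'(1)]) blast
  note clC = bounded_selfadjoint_clinear[OF C(1)]
  have CJ: "C (J g) = 0" if g: "g \<in> M1" for g
  proof (rule cinner_eqI)
    fix y
    have "cinner y (C (J g)) = cinner (C y) (J g)" by (rule bounded_selfadjoint_cinner[OF C(1), symmetric])
    then show "cinner y (C (J g)) = cinner y 0" using M1'(3)[OF C(2) g] by simp
  qed
  have split: "C m + J (C (J m)) = m" if m: "m \<in> M_space J Lp Lm" for m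
  proof -
    obtain f g where fg: "f \<in> M1" "g \<in> M1" "m = f + J g" using M1'(4)[OF m] by blast
    have "C m = f" "C (J m) = g"
      using CJ C(3) fg by (simp_all add: J_add bounded_clinear_add[OF clC])
    then show ?thesis using fg(3) by simp
  qed
  have CC: "C (C x) = C x" for x by (rule C(3)[OF C(2)])
  have qC: "qform C x = (norm (C x))\<^sup>2" for x
    using bounded_selfadjoint_cinner[OF C(1), of "C x" x] by (simp add: qform_def norm_sq_cinner CC)
  have pyth: "(norm (x - C x))\<^sup>2 = (norm x)\<^sup>2 - (norm (C x))\<^sup>2" for x
    using qC[of x] by (simp add: norm_sq_diff qform_def Re_cinner_commute[of x])
  define T where "T x = Tmin x + V (C (V x))" for x
  have Tb: "bounded_selfadjoint T"
    unfolding T_def[abs_def] by (intro bsa_add bsa_conj[OF C(1) V(1)] Tmin_bsa)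
  have qT: "qform T x = qform Tmin x + (norm (C (V x)))\<^sup>2" for x
    unfolding qC[symmetric] by (simp add: T_def qform_def cinner_simps bounded_selfadjoint_cinner[OF V(1)])
  have ext: "extension T"
    unfolding extension_iff op_le_qform
  proof (intro conjI allI Tb)
    fix x
    show "qform Tmin x \<le> qform T x" by (simp add: qT)
    have "(norm (C (V x)))\<^sup>2 \<le> (norm (V x))\<^sup>2" using C(4) by (simp add: power_mono)
    then show "qform T x \<le> qform Tmax x" by (simp add: qT normV)
  qed
  have TJ: "T (J x) = - J (T x)" for x
  proof -
    have "J (T (J x)) = - Tmax x + V (J (C (J (V x))))"
      by (simp add: T_def J_add J_Tmin V(3))
    also have "J (C (J (V x))) = V x - C (V x)" using split[OF VM[of x]] by (simp add: algebra_simps)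
    also have "- Tmax x + V (V x - C (V x)) = - T x"
      by (simp add: bounded_clinear_diff[OF clV] V(2) gap_def T_def)
    finally have "J (J (T (J x))) = J (- T x)" by simp
    then show ?thesis by (simp add: J_minus)
  qed
  have "null_modulo (norm_defect T) S"
    unfolding null_defect_iff[OF ext]
  proof (intro allI impI)
    fix x and e :: real assume "0 < e"
    define m where "m = V x - C (V x)"
    have "m \<in> M_space J Lp Lm" unfolding m_def
      using csubspace_diff[OF Msub VM] C(2) M1'(2) by blast
    then obtain u where u: "dist (V u) m < sqrt e"
      unfolding M closure_approachable using \<open>0 < e\<close> by (metis imageE real_sqrt_gt_zero)
    define r where "r = V u - m"
    have "(norm r)\<^sup>2 < (sqrt e)\<^sup>2"
      using u unfolding r_def dist_norm by (rule power_strict_mono) auto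
    then have r: "(norm r)\<^sup>2 < e" using \<open>0 < e\<close> by simp
    have "C m = 0" by (simp add: m_def bounded_clinear_diff[OF clC] CC)
    then have Cr: "C (V u) = C r" by (simp add: r_def bounded_clinear_diff[OF clC])
    have "V (x - u) = C (V x) - r" by (simp add: r_def m_def bounded_clinear_diff[OF clV])
    then have "V (x - u) - C (V (x - u)) = - (r - C r)"
      by (simp add: bounded_clinear_diff[OF clC] CC)
    then have "(norm (V (x - u)))\<^sup>2 - (norm (C (V (x - u))))\<^sup>2 = (norm r)\<^sup>2 - (norm (C r))\<^sup>2"
      unfolding pyth[symmetric] by (simp only: norm_minus_cancel)
    then have "(qform T u - qform Tmin u) + (qform Tmax (x - u) - qform T (x - u)) = (norm r)\<^sup>2"
      using normV[of "x - u"] Cr by (simp add: qT)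
    then show "\<exists>u. (qform T u - qform Tmin u) + (qform Tmax (x - u) - qform T (x - u)) < e"
      using r by (intro exI[of _ u]) simp
  qed
  then show ?thesis using ext TJ by blast
qed

end

theorem theorem4p5:
  fixes J :: "'a::chilbert_space \<Rightarrow> 'a" and Lp Lm :: "'a set"
  assumes "fundamental_symmetry J"
    and "dual_definite J Lp Lm"
    and "closure {f + g |f g. f \<in> Lp \<and> g \<in> Lm} = UNIV"
    and "\<not> (\<exists>!G. nonnegative_sa_extension (G_zero J Lp Lm) G)"
  shows "quasi_maximal J Lp Lm \<longleftrightarrow>
    (\<exists>M1. hypermaximal_neutral J (M_space J Lp Lm) M1)"
proof -
  interpret dual_definite_pair J Lp Lm by unfold_locales (fact assms)+
  show ?thesis
    unfolding quasi_maximal_iff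
    using hypermaximal_of_quasi_maximal quasi_maximal_of_hypermaximal by blast
qed

end
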